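(* As formal power series, $A_{\{1,5\}}(x,y) = \dfrac{f}{g}$, where \begin{align*} f &= 1-x^3y-x^4y^2-2x^5y-x^6y^2+x^8y^2+x^{10}y^2,\\ g &= (1-xy-x^5y^5)\,f-2x^5y^2(x+y+x^2y-x^4y-x^6y), \end{align*} and for any integer $c \geq 1$, $A_{\{c,5c\}}(x,y) = A_{\{1,5\}}(x^c,y^c)$.
   Context: A composition of $n$ is an ordered list of positive integers (parts) with sum $n$; the empty list is the unique composition of $0$. A meander on $n$ nodes is a pair $\frac{\lambda}{\mu}$ of compositions of $n$, viewed as a planar (multi)graph on vertices $1,\dots,n$: for each part $a$ of $\lambda$, occupying the consecutive vertices $p+1,\dots,p+a$ (where $p$ is the sum of the preceding parts), there is an upper edge joining $p+i$ and $p+a+1-i$ for each $1\le i\le \lfloor a/2\rfloor$; lower edges are defined in the same way from $\mu$. If the same two vertices are joined by both an upper and a lower edge, both edges are kept and form a cycle. Every connected component is a cycle or a path (an isolated vertex counts as a path). The index is $\operatorname{ind}(\frac{\lambda}{\mu}) = 2c+p$, where here $c$ is the number of cycles and $p$ is the number of paths (this equals the index of the associated seaweed subalgebra of $\mathfrak{gl}_n$). For a set $J$ of positive integers, $a^J_{n,k}$ is the number of meanders $\frac{\lambda}{\mu}$ on $n$ nodes of index $k$ such that all parts of $\lambda$ and $\mu$ lie in $J$, and $A_J(x,y)=\sum_{n,k\ge 0} a^J_{n,k}x^ny^k$ (the empty meander gives $a^J_{0,0}=1$). *)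

theory Defs
  imports "HOL-Computational_Algebra.Formal_Power_Series" "HOL-Library.Multiset"
begin

definition composition :: "nat \<Rightarrow> nat list \<Rightarrow> bool" where
  "composition n as \<longleftrightarrow> (\<forall>a\<in>set as. 0 < a) \<and> sum_list as = n"

(* The first argument of arcs is the number of vertices preceding the current block. *)
fun arcs :: "nat \<Rightarrow> nat list \<Rightarrow> nat set multiset" where
  "arcs p [] = {#}"
| "arcs p (a # as) =
     image_mset (\<lambda>i. {p + i, p + a + 1 - i}) (mset_set {1..a div 2}) + arcs (p + a) as"

type_synonym meander = "nat list \<times> nat list"

definition is_meander :: "nat \<Rightarrow> meander \<Rightarrow> bool" where
  "is_meander n M \<longleftrightarrow> composition n (fst M) \<and> composition n (snd M)"

(* For a meander both compositions have the same sum, so using the first one is no restriction. *)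
definition vertices :: "meander \<Rightarrow> nat set" where
  "vertices M = {1..sum_list (fst M)}"

(* A multiset, so that an upper and a lower edge with the same endpoints are both kept. *)
definition edges :: "meander \<Rightarrow> nat set multiset" where
  "edges M = arcs 0 (fst M) + arcs 0 (snd M)"

definition components :: "meander \<Rightarrow> nat set set" where
  "components M = vertices M // {(u, v). {u, v} \<in># edges M}\<^sup>*"

definition edges_within :: "meander \<Rightarrow> nat set \<Rightarrow> nat set multiset" where
  "edges_within M C = {#e \<in># edges M. e \<subseteq> C#}"

(* A one-element list vs gives an isolated vertex. *)
definition is_path_on :: "meander \<Rightarrow> nat set \<Rightarrow> bool" where
  "is_path_on M C \<longleftrightarrow> (\<exists>vs. vs \<noteq> [] \<and> distinct vs \<and> set vs = C \<and>
     edges_within M C = mset (map2 (\<lambda>u v. {u, v}) vs (tl vs)))"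

(* For vs = [u, v] the prescribed edges are two parallel copies of {u, v}. *)
definition is_cycle_on :: "meander \<Rightarrow> nat set \<Rightarrow> bool" where
  "is_cycle_on M C \<longleftrightarrow> (\<exists>vs. 2 \<le> length vs \<and> distinct vs \<and> set vs = C \<and>
     edges_within M C = mset (map2 (\<lambda>u v. {u, v}) vs (rotate1 vs)))"

definition meander_index :: "meander \<Rightarrow> nat" where
  "meander_index M =
     2 * card {C \<in> components M. is_cycle_on M C} + card {C \<in> components M. is_path_on M C}"

definition meander_count :: "nat set \<Rightarrow> nat \<Rightarrow> nat \<Rightarrow> nat" where
  "meander_count J n k =
     card {M. is_meander n M \<and> set (fst M) \<subseteq> J \<and> set (snd M) \<subseteq> J \<and> meander_index M = k}"

(* Series in x whose coefficients are series in y: the outer fps_X is x, and y is fps_const fps_X. *)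
type_synonym bifps = "rat fps fps"

definition meander_gf :: "nat set \<Rightarrow> bifps" where
  "meander_gf J = Abs_fps (\<lambda>n. Abs_fps (\<lambda>k. of_nat (meander_count J n k)))"

(* F(x^c, y^c); both compositions are genuine substitutions only for c > 0. *)
definition subst_powers :: "nat \<Rightarrow> bifps \<Rightarrow> bifps" where
  "subst_powers c F =
     fps_compose (Abs_fps (\<lambda>n. fps_compose (fps_nth F n) (fps_X ^ c))) (fps_X ^ c)"

end

theory Submission
  imports Defs
begin

unbundle fps_syntax

text \<open>Let \<open>\<sigma>\<close> and \<open>\<tau>\<close> be the involutions of \<open>{1..n}\<close> that reverse each block of the upper and of the
  lower composition. A path of the meander is one orbit of \<open>\<sigma> \<circ> \<tau>\<close> and a cycle splits into two,
  so the index is the number of orbits of \<open>\<sigma> \<circ> \<tau>\<close>. Passing to first-return maps gives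
  Panyushev's reductions of the index. With parts 1 and 5 only five pairs of prefixes occur when
  these reductions are applied while the two compositions are read from left to right, and the
  generating functions of the possible completions satisfy a linear system whose solution is
  \<open>f / g\<close>. Multiplying all parts by \<open>c\<close> replaces every orbit by \<open>c\<close> copies.\<close>

section \<open>Orbits of a map\<close>

text \<open>Orbits absorb the weights 2 and 1 of cycles and paths. Along a component
  \<open>\<sigma> \<circ> \<tau>\<close> moves by two positions: on a cycle the parity of the
  position is kept, while at an end of a path a fixed point of one involution makes the orbit turn
  round and pick up the other parity. Deleting vertices then needs no case distinction by component
  type. Each reduction rewrites leading parts only, whatever follows, so it acts on pairs of
  prefixes. The side with the smaller sum must be continued by 1 or 5, and leading parts are reduced
  against each other until one prefix is used up. In the five pairs that survive one prefix is empty
  and the other is \<open>[]\<close>, \<open>[1]\<close>, \<open>[1, 1]\<close>,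
  \<open>[1, 1, 1]\<close> or \<open>[3, 1]\<close>; the part 3 is 5 - 2, the middle left over when
  1 is reduced against 5.\<close>

definition orbit_rel :: "('a \<Rightarrow> 'a) \<Rightarrow> 'a set \<Rightarrow> ('a \<times> 'a) set" where
  "orbit_rel p V = {(u, v). u \<in> V \<and> v = p u \<or> v \<in> V \<and> u = p v}\<^sup>*"

definition orbits :: "('a \<Rightarrow> 'a) \<Rightarrow> 'a set \<Rightarrow> 'a set set" where
  "orbits p V = V // orbit_rel p V"

lemma equiv_orbit_rel: "equiv UNIV (orbit_rel p V)"
proof -
  have "sym {(u, v). u \<in> V \<and> v = p u \<or> v \<in> V \<and> u = p v}" by (auto simp: sym_def)
  then show ?thesis
    unfolding orbit_rel_def equiv_def
    by (simp add: refl_rtrancl trans_rtrancl sym_rtrancl)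
qed

lemma orbit_rel_refl [simp]: "(u, u) \<in> orbit_rel p V"
  by (simp add: orbit_rel_def)

lemma orbit_rel_sym: "(u, v) \<in> orbit_rel p V \<Longrightarrow> (v, u) \<in> orbit_rel p V"
  using equiv_orbit_rel[of p V] by (auto simp: equiv_def sym_def)

lemma orbit_rel_trans:
  "(u, v) \<in> orbit_rel p V \<Longrightarrow> (v, w) \<in> orbit_rel p V \<Longrightarrow> (u, w) \<in> orbit_rel p V"
  unfolding orbit_rel_def by (rule rtrancl_trans)

lemma orbit_rel_step: "u \<in> V \<Longrightarrow> (u, p u) \<in> orbit_rel p V"
  unfolding orbit_rel_def by (rule r_into_rtrancl) auto

lemma orbit_rel_class_eq:
  "orbit_rel p V `` {u} = orbit_rel p V `` {v} \<longleftrightarrow> (u, v) \<in> orbit_rel p V"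
  using eq_equiv_class_iff[OF equiv_orbit_rel, of u v p V] by simp

lemma orbit_rel_invariant:
  assumes uv: "(u, v) \<in> orbit_rel p V"
    and step: "\<And>a. a \<in> V \<Longrightarrow> r (p a) = r a"
  shows "r u = r v"
  using uv unfolding orbit_rel_def
  by (induction rule: rtrancl_induct) (use step in auto)

text \<open>Single steps need only go to connected pairs, not to single steps; this makes the lemma
  fit an embedding as well as a retraction, under which steps may lengthen or collapse.\<close>

lemma orbit_rel_mapI:
  assumes uv: "(u, v) \<in> orbit_rel p V"
    and step: "\<And>a. a \<in> V \<Longrightarrow> (h a, h (p a)) \<in> orbit_rel q W"
  shows "(h u, h v) \<in> orbit_rel q W"
  using uv unfolding orbit_rel_def
proof (induction rule: rtrancl_induct)
  case (step a b)
  then have "(h a, h b) \<in> orbit_rel q W"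
    using assms(2) orbit_rel_sym by fast
  with step.IH show ?case
    using orbit_rel_trans unfolding orbit_rel_def by fast
qed simp

text \<open>The relation is generated by steps in both directions, so a permutation and its inverse
  have the same orbits. This makes the order in which two involutions are composed
  immaterial.\<close>

lemma orbit_rel_inverse:
  assumes "\<And>u. u \<in> V \<Longrightarrow> p u \<in> V \<and> q (p u) = u"
    and "\<And>u. u \<in> V \<Longrightarrow> q u \<in> V \<and> p (q u) = u"
  shows "orbit_rel p V = orbit_rel q V"
proof -
  have "{(u, v). u \<in> V \<and> v = p u \<or> v \<in> V \<and> u = p v}
      = {(u, v). u \<in> V \<and> v = q u \<or> v \<in> V \<and> u = q v}"
    using assms by auto
  then show ?thesis by (simp add: orbit_rel_def)
qed

section \<open>Comparing and adding orbit counts\<close>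

lemma card_image_eq_of_same_kernel:
  assumes "\<And>u v. u \<in> A \<Longrightarrow> v \<in> A \<Longrightarrow> f u = f v \<longleftrightarrow> g u = g v"
  shows "card (f ` A) = card (g ` A)"
proof -
  let ?h = "\<lambda>z. g (inv_into A f z)"
  have h: "?h (f u) = g u" if "u \<in> A" for u
    using assms[of "inv_into A f (f u)" u] that
    by (simp add: inv_into_into f_inv_into_f)
  have "inj_on ?h (f ` A)"
  proof (rule inj_onI)
    fix x z assume "x \<in> f ` A" "z \<in> f ` A" and e: "?h x = ?h z"
    then obtain u v where u: "u \<in> A" "x = f u" and v: "v \<in> A" "z = f v" by auto
    with e h have "g u = g v" by simp
    with u v assms show "x = z" by simp
  qed
  moreover have "?h ` f ` A = g ` A"
    using h by (auto simp: image_iff)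
  ultimately show ?thesis
    using card_image by metis
qed

lemma orbits_image: "orbits p V = (\<lambda>u. orbit_rel p V `` {u}) ` V"
  by (auto simp: orbits_def quotient_def)

text \<open>The map \<open>i\<close> embeds \<open>W\<close> as a set that meets every orbit of \<open>p\<close>, and \<open>r\<close> follows an orbit
  until it hits this set; the hypotheses say that \<open>q\<close> is the first-return map.\<close>

lemma card_orbits_retract:
  assumes i: "\<And>u. u \<in> W \<Longrightarrow> i u \<in> V \<and> r (i u) = u"
    and step: "\<And>u. u \<in> W \<Longrightarrow> (i u, i (q u)) \<in> orbit_rel p V"
    and r: "\<And>v. v \<in> V \<Longrightarrow> r v \<in> W \<and> (v, i (r v)) \<in> orbit_rel p V"
    and rp: "\<And>v. v \<in> V \<Longrightarrow> (r v, r (p v)) \<in> orbit_rel q W"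
  shows "card (orbits p V) = card (orbits q W)"
proof -
  have iff: "(u, v) \<in> orbit_rel q W \<longleftrightarrow> (i u, i v) \<in> orbit_rel p V" if "u \<in> W" "v \<in> W" for u v
  proof
    assume "(u, v) \<in> orbit_rel q W"
    then show "(i u, i v) \<in> orbit_rel p V" by (rule orbit_rel_mapI) (rule step)
  next
    assume "(i u, i v) \<in> orbit_rel p V"
    then have "(r (i u), r (i v)) \<in> orbit_rel q W" by (rule orbit_rel_mapI) (rule rp)
    then show "(u, v) \<in> orbit_rel q W" using i that by simp
  qed
  have "orbits p V = (\<lambda>u. orbit_rel p V `` {i u}) ` W"
  proof (rule set_eqI, rule iffI)
    fix X assume "X \<in> orbits p V"
    then obtain v where v: "v \<in> V" "X = orbit_rel p V `` {v}" by (auto simp: orbits_image)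
    with r[OF v(1)] show "X \<in> (\<lambda>u. orbit_rel p V `` {i u}) ` W"
      using orbit_rel_class_eq by fast
  next
    fix X assume "X \<in> (\<lambda>u. orbit_rel p V `` {i u}) ` W"
    then show "X \<in> orbits p V" using i by (auto simp: orbits_image)
  qed
  then show ?thesis
    unfolding orbits_image[of q W]
    by (simp only:) (rule card_image_eq_of_same_kernel, simp only: orbit_rel_class_eq iff)
qed

lemma orbits_subset:
  assumes "\<And>u. u \<in> V \<Longrightarrow> p u \<in> V" and "X \<in> orbits p V"
  shows "X \<subseteq> V"
proof
  fix v assume v: "v \<in> X"
  obtain u where u: "u \<in> V" "(u, v) \<in> orbit_rel p V"
    using assms(2) v by (auto simp: orbits_image)
  from u(2) show "v \<in> V" unfolding orbit_rel_def
    by (induction rule: rtrancl_induct) (use u(1) assms(1) in auto)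
qed

text \<open>A backward step cannot leave \<open>A\<close> either: its source would lie in
  \<open>B\<close>, and \<open>p\<close> maps \<open>B\<close> into \<open>B\<close>, which is
  disjoint from \<open>A\<close>.\<close>

lemma orbit_rel_restrict:
  assumes A: "\<And>u. u \<in> A \<Longrightarrow> p u \<in> A" and B: "\<And>u. u \<in> B \<Longrightarrow> p u \<in> B"
    and disj: "A \<inter> B = {}" and u: "u \<in> A"
  shows "orbit_rel p (A \<union> B) `` {u} = orbit_rel p A `` {u}"
proof -
  have "(u, v) \<in> orbit_rel p A \<and> v \<in> A" if "(u, v) \<in> orbit_rel p (A \<union> B)" for v
    using that unfolding orbit_rel_def
  proof (induction rule: rtrancl_induct)
    case base then show ?case using u by simp
  next
    case (step v w)
    then have "v \<in> A" by blast
    with step(2) have "w \<in> A \<and> (v, w) \<in> {(u, v). u \<in> A \<and> v = p u \<or> v \<in> A \<and> u = p v}"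
      using A B disj by auto
    with step.IH show ?case by (auto intro: rtrancl_into_rtrancl)
  qed
  moreover have "(u, v) \<in> orbit_rel p (A \<union> B)" if "(u, v) \<in> orbit_rel p A" for v
    using that orbit_rel_mapI[of u v p A id p "A \<union> B"] orbit_rel_step[of _ "A \<union> B" p] by auto
  ultimately show ?thesis by auto
qed

lemma orbits_Un:
  assumes A: "\<And>u. u \<in> A \<Longrightarrow> p u \<in> A" and B: "\<And>u. u \<in> B \<Longrightarrow> p u \<in> B"
    and disj: "A \<inter> B = {}"
  shows "orbits p (A \<union> B) = orbits p A \<union> orbits p B"
proof -
  have 1: "orbit_rel p (A \<union> B) `` {u} = orbit_rel p A `` {u}" if "u \<in> A" for u
    using orbit_rel_restrict[of A p B u] assms that by blast
  have "orbit_rel p (B \<union> A) `` {u} = orbit_rel p B `` {u}" if "u \<in> B" for u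
    using orbit_rel_restrict[of B p A u] assms that by blast
  then have 2: "orbit_rel p (A \<union> B) `` {u} = orbit_rel p B `` {u}" if "u \<in> B" for u
    using that by (simp add: Un_commute)
  show ?thesis
    unfolding orbits_image image_Un using 1 2 by (simp cong: image_cong)
qed

lemma finite_orbits: "finite V \<Longrightarrow> finite (orbits p V)"
  by (simp add: orbits_image)

lemma orbits_nonempty: "X \<in> orbits p V \<Longrightarrow> X \<noteq> {}"
  using orbit_rel_refl[of _ p V] unfolding orbits_image by (elim imageE) blast

lemma card_orbits_Un:
  assumes A: "\<And>u. u \<in> A \<Longrightarrow> p u \<in> A" and B: "\<And>u. u \<in> B \<Longrightarrow> p u \<in> B"
    and disj: "A \<inter> B = {}" and fin: "finite A" "finite B"
  shows "card (orbits p (A \<union> B)) = card (orbits p A) + card (orbits p B)"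
proof -
  have "orbits p A \<inter> orbits p B = {}"
    using orbits_subset[of A p, OF A] orbits_subset[of B p, OF B] orbits_nonempty[of _ p A] disj
    by fastforce
  then show ?thesis
    using orbits_Un[of A p B, OF A B disj] fin by (simp add: card_Un_disjoint finite_orbits)
qed

lemma card_orbits_UN:
  assumes "finite I" and "\<And>i. i \<in> I \<Longrightarrow> finite (A i)"
    and "\<And>i u. i \<in> I \<Longrightarrow> u \<in> A i \<Longrightarrow> p u \<in> A i"
    and "\<And>i j. i \<in> I \<Longrightarrow> j \<in> I \<Longrightarrow> i \<noteq> j \<Longrightarrow> A i \<inter> A j = {}"
  shows "card (orbits p (\<Union>i\<in>I. A i)) = (\<Sum>i\<in>I. card (orbits p (A i)))"
  using assms
proof (induction I rule: finite_induct)
  case empty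
  then show ?case by (simp add: orbits_image)
next
  case (insert i I)
  have "card (orbits p (A i \<union> (\<Union>j\<in>I. A j)))
      = card (orbits p (A i)) + card (orbits p (\<Union>j\<in>I. A j))"
  proof (rule card_orbits_Un)
    show "A i \<inter> (\<Union>j\<in>I. A j) = {}"
      using insert.hyps insert.prems(3)[of i] by auto
  qed (use insert.hyps insert.prems in auto)
  then show ?case using insert by simp
qed

lemma card_orbits_id:
  assumes "\<And>u. u \<in> V \<Longrightarrow> p u = u"
  shows "card (orbits p V) = card V"
proof -
  have "inj_on (\<lambda>u. orbit_rel p V `` {u}) V"
  proof (rule inj_onI)
    fix u v assume "orbit_rel p V `` {u} = orbit_rel p V `` {v}"
    then have "(u, v) \<in> orbit_rel p V" by (simp add: orbit_rel_class_eq)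
    then show "u = v" using orbit_rel_invariant[of u v p V "\<lambda>x. x"] assms by simp
  qed
  then show ?thesis by (simp add: orbits_image card_image)
qed

section \<open>Meanders as pairs of involutions\<close>

text \<open>Being a set, it holds each arc once although the arc arises from both of its endpoints;
  a fixed point gives no loop.\<close>

definition pair_edges :: "('a \<Rightarrow> 'a) \<Rightarrow> 'a set \<Rightarrow> 'a set set" where
  "pair_edges s C = {{u, s u} |u. u \<in> C \<and> s u \<noteq> u}"

definition path_graph :: "'a set multiset \<Rightarrow> 'a set \<Rightarrow> bool" where
  "path_graph E C \<longleftrightarrow> (\<exists>vs. vs \<noteq> [] \<and> distinct vs \<and> set vs = C \<and>
     E = mset (map2 (\<lambda>u v. {u, v}) vs (tl vs)))"

definition cycle_graph :: "'a set multiset \<Rightarrow> 'a set \<Rightarrow> bool" where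
  "cycle_graph E C \<longleftrightarrow> (\<exists>vs. 2 \<le> length vs \<and> distinct vs \<and> set vs = C \<and>
     E = mset (map2 (\<lambda>u v. {u, v}) vs (rotate1 vs)))"

text \<open>Together with the edge count of a cycle this shows that no component is both a path and
  a cycle, so the two terms of the index never count it twice.\<close>

lemma path_graph_size:
  assumes "path_graph E C" shows "Suc (size E) = card C"
proof -
  from assms obtain vs where "vs \<noteq> []" "distinct vs" "set vs = C"
    "E = mset (map2 (\<lambda>u v. {u, v}) vs (tl vs))" unfolding path_graph_def by blast
  then show ?thesis using distinct_card[of vs] by (cases vs) auto
qed

lemma cycle_graph_size:
  assumes "cycle_graph E C" shows "size E = card C"
  using assms by (auto simp: cycle_graph_def distinct_card)

section \<open>Alternating walks of two involutions\<close>

fun walk :: "('a \<Rightarrow> 'a) \<Rightarrow> ('a \<Rightarrow> 'a) \<Rightarrow> 'a \<Rightarrow> nat \<Rightarrow> 'a" where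
  "walk s t v 0 = v"
| "walk s t v (Suc k) = (if even k then s else t) (walk s t v k)"

declare walk.simps(2) [simp del]

lemma doubleton_inj_on:
  assumes "inj_on w A" "j \<in> A" "j' \<in> A" "k \<in> A" "k' \<in> A"
    and "{w j, w j'} = {w k, w k'}"
  shows "{j, j'} = {k, k'}"
  using inj_on_image_eq_iff[OF assms(1), of "{j, j'}" "{k, k'}"] assms by simp

text \<open>Edges at even positions come from \<open>s\<close>, those at odd positions from
  \<open>t\<close>, and repetitions are excluded only within one parity: in a closed walk with
  \<open>m = 2\<close> both edges are the same pair and must be counted twice. Hence the sum of two
  multisets instead of one set of edges.\<close>

lemma mset_walk_edges:
  fixes w :: "nat \<Rightarrow> 'a"
  assumes inj: "inj_on w {..<m}" and n: "n < m \<or> n = m \<and> even m \<and> w m = w 0"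
  shows "mset (map (\<lambda>j. {w j, w (Suc j)}) [0..<n])
    = mset_set ((\<lambda>j. {w j, w (Suc j)}) ` {j. j < n \<and> even j})
    + mset_set ((\<lambda>j. {w j, w (Suc j)}) ` {j. j < n \<and> odd j})"
proof -
  let ?e = "\<lambda>j. {w j, w (Suc j)}"
  let ?c = "\<lambda>j. if j = m then 0 else j"
  have e: "?e j = {w j, w (?c (Suc j))}" if "j < n" for j
    using n that by auto
  have key: "j = k" if jk: "j < n" "k < n" "even j = even k" "?e j = ?e k" for j k
  proof -
    have bounds: "j < m" "k < m" "?c (Suc j) < m" "?c (Suc k) < m"
      using n jk by auto
    have "{j, ?c (Suc j)} = {k, ?c (Suc k)}"
      by (rule doubleton_inj_on[OF inj]) (use bounds jk e in auto)
    then have "j = k \<or> j = ?c (Suc k) \<and> ?c (Suc j) = k"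
      by (auto simp: doubleton_eq_iff)
    \<comment> \<open>A crosswise coincidence makes \<open>j\<close> the cyclic successor of
      \<open>k\<close>. Equal parity leaves only the wrap-around \<open>k = m - 1\<close>,
      \<open>j = 0\<close>, where the parities differ because \<open>m\<close> is even.\<close>
    moreover have "odd k" if "j = ?c (Suc k)"
      using that jk n by (cases "Suc k = m") auto
    moreover have "even k" if "j = ?c (Suc k)"
      using that jk n by (cases "Suc k = m") auto
    ultimately show "j = k" by blast
  qed
  have "inj_on ?e {j. j < n \<and> even j}" "inj_on ?e {j. j < n \<and> odd j}"
    using key by (auto intro!: inj_onI)
  then have "mset_set (?e ` {j. j < n \<and> even j}) + mset_set (?e ` {j. j < n \<and> odd j})
      = image_mset ?e (mset_set {j. j < n \<and> even j} + mset_set {j. j < n \<and> odd j})"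
    by (simp add: image_mset_mset_set)
  also have "mset_set {j. j < n \<and> even j} + mset_set {j. j < n \<and> odd j}
      = mset_set ({j. j < n \<and> even j} \<union> {j. j < n \<and> odd j})"
    by (rule mset_set_Union[symmetric]) auto
  also have "{j. j < n \<and> even j} \<union> {j. j < n \<and> odd j} = set [0..<n]" by auto
  also have "image_mset ?e (mset_set (set [0..<n])) = mset (map ?e [0..<n])"
    by (simp add: mset_set_set)
  finally show ?thesis by simp
qed

lemma map2_upt_tl:
  "map2 f (map w [0..<m]) (tl (map w [0..<m])) = map (\<lambda>j. f (w j) (w (Suc j))) [0..<m - 1]"
  by (rule nth_equalityI) (auto simp: nth_tl)

lemma map2_upt_rotate1:
  assumes "w m = w 0"
  shows "map2 f (map w [0..<m]) (rotate1 (map w [0..<m])) = map (\<lambda>j. f (w j) (w (Suc j))) [0..<m]"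
proof (rule nth_equalityI, goal_cases)
  case 1 show ?case by simp
next
  case (2 j)
  then have "j < m" by simp
  then have "rotate1 (map w [0..<m]) ! j = w (Suc j)"
    using assms by (cases "Suc j = m") (auto simp: nth_rotate1)
  then show ?case using \<open>j < m\<close> by simp
qed

locale two_involutions =
  fixes V :: "'a set" and s t :: "'a \<Rightarrow> 'a"
  assumes finite_V: "finite V"
    and s_closed: "v \<in> V \<Longrightarrow> s v \<in> V" and s_s: "v \<in> V \<Longrightarrow> s (s v) = v"
    and t_closed: "v \<in> V \<Longrightarrow> t v \<in> V" and t_t: "v \<in> V \<Longrightarrow> t (t v) = v"
begin

definition conn :: "('a \<times> 'a) set" where
  "conn = {(u, w). u \<in> V \<and> (w = s u \<or> w = t u)}\<^sup>*"

definition graph_edges :: "'a set \<Rightarrow> 'a set multiset" where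
  "graph_edges C = mset_set (pair_edges s C) + mset_set (pair_edges t C)"

lemma equiv_conn: "equiv UNIV conn"
proof -
  have "{(u, w). u \<in> V \<and> (w = s u \<or> w = t u)}
     = {(u, w). u \<in> V \<and> w \<in> V \<and> (w = s u \<or> w = t u)}"
    using s_closed t_closed by auto
  moreover have "sym {(u, w). u \<in> V \<and> w \<in> V \<and> (w = s u \<or> w = t u)}"
    using s_s t_t by (auto simp: sym_def)
  ultimately have "sym conn" by (simp add: conn_def sym_rtrancl)
  then show ?thesis
    unfolding equiv_def conn_def by (simp add: refl_rtrancl trans_rtrancl)
qed

lemma walk_in: "v \<in> V \<Longrightarrow> walk s t v k \<in> V"
  by (induction k) (auto simp: s_closed t_closed walk.simps(2))

lemma walk_Suc_inverse:
  "v \<in> V \<Longrightarrow> (if even k then s else t) (walk s t v (Suc k)) = walk s t v k"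
  using walk_in[of v k] by (simp add: s_s t_t walk.simps(2))

text \<open>A walk revisits an old vertex only by standing still or by returning to its start: an
  interior vertex already has both its neighbours on the walk.\<close>

lemma walk_first_repetition:
  assumes v: "v \<in> V"
  obtains m where "0 < m" "inj_on (walk s t v) {..<m}"
    "walk s t v m = walk s t v (m - 1) \<or> walk s t v m = walk s t v 0 \<and> even m"
proof -
  let ?w = "walk s t v"
  have "\<not> inj ?w"
  proof
    assume "inj ?w"
    then have "infinite (range ?w)" by (metis finite_imageD infinite_UNIV_nat)
    moreover have "range ?w \<subseteq> V" using walk_in v by auto
    ultimately show False using finite_V finite_subset by blast
  qed
  then have ex: "\<exists>m. ?w m \<in> ?w ` {..<m}"
    unfolding inj_def by (metis imageI lessThan_iff linorder_neqE_nat)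
  define m where "m = (LEAST m. ?w m \<in> ?w ` {..<m})"
  have rep: "?w m \<in> ?w ` {..<m}" unfolding m_def using ex by (rule LeastI_ex)
  have least: "?w k \<notin> ?w ` {..<k}" if "k < m" for k
    using not_less_Least that unfolding m_def by blast
  have inj: "inj_on ?w {..<m}"
  proof (rule inj_onI)
    fix j k assume jk: "j \<in> {..<m}" "k \<in> {..<m}" "?w j = ?w k"
    show "j = k"
    proof (rule linorder_cases[of j k])
      assume "j < k" then show ?thesis using least[of k] jk by (metis imageI lessThan_iff)
    next
      assume "k < j" then show ?thesis using least[of j] jk by (metis imageI lessThan_iff)
    qed
  qed
  have m: "0 < m" using rep by (cases m) auto
  obtain i where i: "i < m" "?w m = ?w i" using rep by auto
  have prev: "?w (m - 1) = (if even (m - 1) then s else t) (?w i)"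
    using walk_Suc_inverse[OF v, of "m - 1"] m i by simp
  \<comment> \<open>By \<open>prev\<close>, \<open>?w (m - 1)\<close> is a neighbour of
    \<open>?w i\<close>: under equal parity it is \<open>?w (Suc i)\<close>, otherwise
    \<open>?w (i - 1)\<close> when \<open>i\<close> is not 0. Injectivity below \<open>m\<close>
    then forces equal positions, which is impossible.\<close>
  have up: False if "even (m - 1) = even i" "i \<noteq> m - 1"
  proof -
    have "?w (m - 1) = ?w (Suc i)" using prev that(1) by (simp add: walk.simps(2))
    then have "m - 1 = Suc i" using inj_onD[OF inj] i(1) that(2) m by fastforce
    then show False using that(1) by simp
  qed
  have down: "i = 0" if "even (m - 1) \<noteq> even i"
  proof (rule ccontr)
    assume "i \<noteq> 0"
    then obtain k where k: "i = Suc k" using not0_implies_Suc by blast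
    then have "?w (m - 1) = ?w k"
      using prev that walk_Suc_inverse[OF v, of k] by auto
    then have "m - 1 = k" using inj_onD[OF inj] i(1) k m by fastforce
    then show False using i(1) k by simp
  qed
  have "?w m = ?w (m - 1) \<or> ?w m = ?w 0 \<and> even m"
  proof (cases "i = m - 1")
    case False
    then have "i = 0" "even (m - 1) \<noteq> even i" using up down by blast+
    then show ?thesis using i(2) m by auto
  qed (use i in simp)
  with m inj show ?thesis by (rule that)
qed

text \<open>Both neighbours of any vertex of the segment lie in the segment again, so a chain of
  adjacent vertices from \<open>v\<close> never leaves it.\<close>

lemma conn_class_walk:
  assumes v: "v \<in> V"
    and s: "\<And>j. j < m \<Longrightarrow> s (walk s t v j) \<in> walk s t v ` {..<m}"
    and t: "\<And>j. j < m \<Longrightarrow> t (walk s t v j) \<in> walk s t v ` {..<m}"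
    and m: "0 < m"
  shows "conn `` {v} = walk s t v ` {..<m}"
proof
  show "conn `` {v} \<subseteq> walk s t v ` {..<m}"
  proof
    fix u assume "u \<in> conn `` {v}"
    then have "(v, u) \<in> conn" by simp
    then show "u \<in> walk s t v ` {..<m}" unfolding conn_def
    proof (induction rule: rtrancl_induct)
      case base show ?case using m by (auto intro!: image_eqI[of _ _ 0])
    qed (use s t in auto)
  qed
  have "(v, walk s t v j) \<in> conn" for j
  proof (induction j)
    case (Suc j)
    have "(walk s t v j, walk s t v (Suc j)) \<in> {(u, w). u \<in> V \<and> (w = s u \<or> w = t u)}"
      using walk_in[OF v, of j] by (auto simp: walk.simps(2))
    with Suc show ?case unfolding conn_def by (rule rtrancl_into_rtrancl)
  qed (simp add: conn_def)
  then show "walk s t v ` {..<m} \<subseteq> conn `` {v}" by auto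
qed

text \<open>Two consecutive steps of the walk use both involutions: from an odd position
  \<open>t\<close> and then \<open>s\<close>, which is \<open>s \<circ> t\<close>; from an even
  position \<open>s\<close> and then \<open>t\<close>, which is its inverse.\<close>

lemma walk_orbit_step:
  assumes "v \<in> V" "walk s t v ` {..<m} = C" "Suc (Suc j) < m"
  shows "(walk s t v j, walk s t v (Suc (Suc j))) \<in> orbit_rel (s \<circ> t) C"
proof (cases "even j")
  case True
  then have "(s \<circ> t) (walk s t v (Suc (Suc j))) = walk s t v j"
    using walk_in[OF assms(1), of j] s_closed s_s t_t by (simp add: walk.simps(2))
  moreover have "walk s t v (Suc (Suc j)) \<in> C" using assms by blast
  ultimately show ?thesis by (metis orbit_rel_step orbit_rel_sym)
next
  case False
  then have "(s \<circ> t) (walk s t v j) = walk s t v (Suc (Suc j))" by (simp add: walk.simps(2))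
  moreover have "walk s t v j \<in> C" using assms by auto
  ultimately show ?thesis by (metis orbit_rel_step)
qed

text \<open>The fixed point \<open>v\<close> of \<open>t\<close> is one end of the component. A walk
  that starts there with \<open>s\<close> cannot close up, since its last vertex would be
  \<open>t v = v\<close>; so it stops at a second end. Positions of equal parity share an orbit, and
  \<open>t v = v\<close> joins positions 0 and 1, hence there is a single orbit.\<close>

lemma path_class:
  assumes v: "v \<in> V" and fix_v: "t v = v"
  shows "path_graph (graph_edges (conn `` {v})) (conn `` {v})
    \<and> card (orbits (s \<circ> t) (conn `` {v})) = 1"
proof -
  let ?w = "walk s t v"
  obtain m where m: "0 < m" and inj: "inj_on ?w {..<m}"
    and rep: "?w m = ?w (m - 1) \<or> ?w m = ?w 0 \<and> even m"
    using walk_first_repetition[OF v] .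
  have stop: "?w m = ?w (m - 1)"
  proof (rule ccontr)
    assume "?w m \<noteq> ?w (m - 1)"
    then have e: "?w m = v" "even m" using rep by auto
    then have "?w (m - 1) = t v" using walk_Suc_inverse[OF v, of "m - 1"] m by simp
    then have "?w (m - 1) = ?w 0" using fix_v by simp
    then have "m - 1 = 0" using inj_onD[OF inj] m by fastforce
    then show False using e(2) m by auto
  qed
  have s_even: "s (?w j) = (if Suc j < m then ?w (Suc j) else ?w j)" if "j < m" "even j" for j
    using that stop by (cases "Suc j = m") (auto simp: walk.simps(2))
  have s_odd: "s (?w j) = ?w (j - 1)" if "odd j" for j
    using that walk_Suc_inverse[OF v, of "j - 1"] by (cases j) auto
  have t_odd: "t (?w j) = (if Suc j < m then ?w (Suc j) else ?w j)" if "j < m" "odd j" for j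
    using that stop by (cases "Suc j = m") (auto simp: walk.simps(2))
  have t_even: "t (?w j) = ?w (j - 1)" if "even j" for j
    using that walk_Suc_inverse[OF v, of "j - 1"] fix_v by (cases j) auto
  define C where "C = conn `` {v}"
  have C: "C = ?w ` {..<m}" unfolding C_def
  proof (rule conn_class_walk[OF v _ _ m])
    fix j assume "j < m"
    then show "s (?w j) \<in> ?w ` {..<m}" "t (?w j) \<in> ?w ` {..<m}"
      using s_even s_odd t_even t_odd by (cases "even j"; auto)+
  qed
  have ne: "?w (Suc j) \<noteq> ?w j" if "Suc j < m" for j
    using inj_onD[OF inj, of "Suc j" j] that by auto
  have E: "pair_edges s C = (\<lambda>j. {?w j, ?w (Suc j)}) ` {j. j < m - 1 \<and> even j}"
    (is "_ = ?R")
  proof (rule set_eqI, rule iffI)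
    fix X assume "X \<in> pair_edges s C"
    then obtain j where j: "j < m" "X = {?w j, s (?w j)}" "s (?w j) \<noteq> ?w j"
      unfolding pair_edges_def C by blast
    show "X \<in> ?R"
    proof (cases "even j")
      case True
      with j s_even[of j] have "Suc j < m" by (auto split: if_splits)
      with j s_even[of j] True show ?thesis by (intro image_eqI[of _ _ j]) auto
    next
      case False
      then obtain k where "j = Suc k" "even k" by (cases j) auto
      with j s_odd[of j] show ?thesis by (intro image_eqI[of _ _ k]) auto
    qed
  next
    fix X assume "X \<in> ?R"
    then obtain j where "j < m - 1" "even j" "X = {?w j, ?w (Suc j)}" by blast
    then have j: "Suc j < m" "even j" "X = {?w j, ?w (Suc j)}" by simp_all
    with s_even[of j] ne[of j] have "X = {?w j, s (?w j)}" "s (?w j) \<noteq> ?w j" "?w j \<in> C"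
      by (auto simp: C)
    then show "X \<in> pair_edges s C" unfolding pair_edges_def by blast
  qed
  have Od: "pair_edges t C = (\<lambda>j. {?w j, ?w (Suc j)}) ` {j. j < m - 1 \<and> odd j}"
    (is "_ = ?R")
  proof (rule set_eqI, rule iffI)
    fix X assume "X \<in> pair_edges t C"
    then obtain j where j: "j < m" "X = {?w j, t (?w j)}" "t (?w j) \<noteq> ?w j"
      unfolding pair_edges_def C by blast
    show "X \<in> ?R"
    proof (cases "odd j")
      case True
      with j t_odd[of j] have "Suc j < m" by (auto split: if_splits)
      with j t_odd[of j] True show ?thesis by (intro image_eqI[of _ _ j]) auto
    next
      case False
      with j fix_v have "j \<noteq> 0" by (metis walk.simps(1))
      with False obtain k where "j = Suc k" "odd k" by (cases j) auto
      with j t_even[of j] show ?thesis by (intro image_eqI[of _ _ k]) auto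
    qed
  next
    fix X assume "X \<in> ?R"
    then obtain j where "j < m - 1" "odd j" "X = {?w j, ?w (Suc j)}" by blast
    then have j: "Suc j < m" "odd j" "X = {?w j, ?w (Suc j)}" by simp_all
    with t_odd[of j] ne[of j] have "X = {?w j, t (?w j)}" "t (?w j) \<noteq> ?w j" "?w j \<in> C"
      by (auto simp: C)
    then show "X \<in> pair_edges t C" unfolding pair_edges_def by blast
  qed
  have "path_graph (graph_edges C) C"
    unfolding path_graph_def
  proof (intro exI[of _ "map ?w [0..<m]"] conjI)
    show "graph_edges C = mset (map2 (\<lambda>u v. {u, v}) (map ?w [0..<m]) (tl (map ?w [0..<m])))"
      using mset_walk_edges[OF inj, of "m - 1"] m
      by (simp only: map2_upt_tl graph_edges_def E Od) auto
  qed (use m inj in \<open>auto simp: C distinct_map atLeast0LessThan\<close>)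
  moreover have "card (orbits (s \<circ> t) C) = 1"
  proof -
    have rel: "(?w 0, ?w j) \<in> orbit_rel (s \<circ> t) C" if "j < m" for j
      using that
    proof (induction j rule: less_induct)
      case (less j)
      consider "j = 0" | "j = 1" | k where "j = Suc (Suc k)"
        by (metis One_nat_def not0_implies_Suc)
      then show ?case
      proof cases
        case 2
        then have "(s \<circ> t) (?w 0) = ?w j" using fix_v by (simp add: walk.simps(2))
        moreover have "?w 0 \<in> C" unfolding C using m by blast
        ultimately show ?thesis by (metis orbit_rel_step)
      next
        case 3
        then show ?thesis
          using less walk_orbit_step[OF v C[symmetric], of k] by (metis Suc_lessD lessI orbit_rel_trans)
      qed simp
    qed
    have "orbits (s \<circ> t) C = {orbit_rel (s \<circ> t) C `` {?w 0}}"
    proof -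
      have "orbit_rel (s \<circ> t) C `` {u} = orbit_rel (s \<circ> t) C `` {?w 0}" if "u \<in> C" for u
        using that rel unfolding C by (auto simp only: orbit_rel_class_eq intro: orbit_rel_sym)
      moreover have "?w 0 \<in> C" unfolding C using m by blast
      ultimately show ?thesis unfolding orbits_image by blast
    qed
    then show ?thesis by simp
  qed
  ultimately show ?thesis unfolding C_def by blast
qed

text \<open>Without fixed points the walk never stands still, so it closes up after an even number
  of steps. Each involution exchanges the even positions \<open>E\<close> and the odd positions
  \<open>Od\<close>, so the composition preserves both sets, and each is one orbit.\<close>

lemma cycle_class:
  assumes v: "v \<in> V" and no_fix: "\<And>u. u \<in> conn `` {v} \<Longrightarrow> s u \<noteq> u \<and> t u \<noteq> u"
  shows "cycle_graph (graph_edges (conn `` {v})) (conn `` {v})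
    \<and> card (orbits (s \<circ> t) (conn `` {v})) = 2"
proof -
  let ?w = "walk s t v"
  obtain m where m: "0 < m" and inj: "inj_on ?w {..<m}"
    and rep: "?w m = ?w (m - 1) \<or> ?w m = ?w 0 \<and> even m"
    using walk_first_repetition[OF v] .
  have in_conn: "(v, ?w j) \<in> conn" for j
  proof (induction j)
    case (Suc j)
    have "(?w j, ?w (Suc j)) \<in> {(u, w). u \<in> V \<and> (w = s u \<or> w = t u)}"
      using walk_in[OF v, of j] by (auto simp: walk.simps(2))
    with Suc show ?case unfolding conn_def by (rule rtrancl_into_rtrancl)
  qed (simp add: conn_def)
  have "?w m \<noteq> ?w (m - 1)"
    using no_fix[of "?w (m - 1)"] in_conn[of "m - 1"] m by (cases m) (auto simp: walk.simps(2))
  with rep have return: "?w m = ?w 0" and ev: "even m" by auto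
  have m2: "2 \<le> m" using m ev by presburger
  have s_even: "s (?w j) = ?w (Suc j)" if "even j" for j using that by (simp add: walk.simps(2))
  have s_odd: "s (?w j) = ?w (j - 1)" if "odd j" for j
    using that walk_Suc_inverse[OF v, of "j - 1"] by (cases j) auto
  have t_odd: "t (?w j) = ?w (Suc j)" if "odd j" for j using that by (simp add: walk.simps(2))
  have t_0: "t (?w 0) = ?w (m - 1)"
    using walk_Suc_inverse[OF v, of "m - 1"] return ev m by simp
  have t_even: "t (?w j) = ?w (j - 1)" if "even j" "j \<noteq> 0" for j
    using that walk_Suc_inverse[OF v, of "j - 1"] by (cases j) auto
  define E where "E = ?w ` {j. j < m \<and> even j}"
  define Od where "Od = ?w ` {j. j < m \<and> odd j}"
  have EO: "E \<inter> Od = {}" using inj unfolding E_def Od_def by (auto dest: inj_onD)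
  have s_E: "s u \<in> Od" if u: "u \<in> E" for u
  proof -
    from u obtain j where j: "j < m" "even j" "u = ?w j" unfolding E_def by blast
    then have "Suc j < m" using ev by (cases "Suc j = m") auto
    then show ?thesis using j s_even[of j] unfolding Od_def by auto
  qed
  have s_O: "s u \<in> E" if u: "u \<in> Od" for u
  proof -
    from u obtain j where j: "j < m" "odd j" "u = ?w j" unfolding Od_def by blast
    then show ?thesis using s_odd[of j] unfolding E_def by auto
  qed
  have t_O: "t u \<in> E" if u: "u \<in> Od" for u
  proof -
    from u obtain j where j: "j < m" "odd j" "u = ?w j" unfolding Od_def by blast
    show ?thesis
    proof (cases "Suc j = m")
      case True
      then show ?thesis using j t_odd[of j] return m unfolding E_def by (intro image_eqI[of _ _ 0]) auto
    next
      case False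
      then show ?thesis using j t_odd[of j] unfolding E_def by (intro image_eqI[of _ _ "Suc j"]) auto
    qed
  qed
  have t_E: "t u \<in> Od" if u: "u \<in> E" for u
  proof -
    from u obtain j where j: "j < m" "even j" "u = ?w j" unfolding E_def by blast
    show ?thesis
    proof (cases "j = 0")
      case True
      then show ?thesis using j t_0 m ev unfolding Od_def by (intro image_eqI[of _ _ "m - 1"]) auto
    next
      case False
      then show ?thesis using j t_even[of j] unfolding Od_def by (intro image_eqI[of _ _ "j - 1"]) auto
    qed
  qed
  define C where "C = conn `` {v}"
  have CEO: "?w ` {..<m} = E \<union> Od" unfolding E_def Od_def by auto
  have C: "C = ?w ` {..<m}" unfolding C_def
  proof (rule conn_class_walk[OF v _ _ m])
    fix j assume "j < m"
    then have "?w j \<in> E \<union> Od" using CEO by blast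
    then show "s (?w j) \<in> ?w ` {..<m}" "t (?w j) \<in> ?w ` {..<m}"
      unfolding CEO using s_E s_O t_E t_O by blast+
  qed
  have fix_free: "s u \<noteq> u" "t u \<noteq> u" if "u \<in> C" for u using no_fix that unfolding C_def by auto
  have ES: "pair_edges s C = (\<lambda>j. {?w j, ?w (Suc j)}) ` {j. j < m \<and> even j}"
    (is "_ = ?R")
  proof (rule set_eqI, rule iffI)
    fix X assume "X \<in> pair_edges s C"
    then obtain j where j: "j < m" "X = {?w j, s (?w j)}"
      unfolding pair_edges_def C by blast
    show "X \<in> ?R"
    proof (cases "even j")
      case True
      with j s_even[of j] show ?thesis by (intro image_eqI[of _ _ j]) auto
    next
      case False
      then obtain k where "j = Suc k" "even k" by (cases j) auto
      with j s_odd[of j] show ?thesis by (intro image_eqI[of _ _ k]) auto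
    qed
  next
    fix X assume "X \<in> ?R"
    then obtain j where "j < m" "even j" "X = {?w j, ?w (Suc j)}" by blast
    then have j: "j < m" "even j" "X = {?w j, s (?w j)}" using s_even by simp_all
    with fix_free[of "?w j"] show "X \<in> pair_edges s C" unfolding pair_edges_def C by blast
  qed
  have OT: "pair_edges t C = (\<lambda>j. {?w j, ?w (Suc j)}) ` {j. j < m \<and> odd j}"
    (is "_ = ?R")
  proof (rule set_eqI, rule iffI)
    fix X assume "X \<in> pair_edges t C"
    then obtain j where j: "j < m" "X = {?w j, t (?w j)}"
      unfolding pair_edges_def C by blast
    consider "odd j" | "j = 0" | "even j" "j \<noteq> 0" by blast
    then show "X \<in> ?R"
    proof cases
      case 1
      with j t_odd[of j] show ?thesis by (intro image_eqI[of _ _ j]) auto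
    next
      case 2
      obtain k where k: "m = Suc k" using m by (cases m) auto
      have "X = {?w k, ?w (Suc k)}" unfolding j(2) 2 t_0 k[symmetric] return by (auto simp: k)
      then show ?thesis using ev k by (intro image_eqI[of _ _ k]) auto
    next
      case 3
      then obtain k where "j = Suc k" "odd k" by (cases j) auto
      with j 3 t_even[of j] show ?thesis by (intro image_eqI[of _ _ k]) auto
    qed
  next
    fix X assume "X \<in> ?R"
    then obtain j where "j < m" "odd j" "X = {?w j, ?w (Suc j)}" by blast
    then have j: "j < m" "odd j" "X = {?w j, t (?w j)}" using t_odd by simp_all
    with fix_free[of "?w j"] show "X \<in> pair_edges t C" unfolding pair_edges_def C by blast
  qed
  have "cycle_graph (graph_edges C) C"
    unfolding cycle_graph_def
  proof (intro exI[of _ "map ?w [0..<m]"] conjI)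
    show "graph_edges C = mset (map2 (\<lambda>u v. {u, v}) (map ?w [0..<m]) (rotate1 (map ?w [0..<m])))"
      unfolding map2_upt_rotate1[of ?w, OF return] graph_edges_def ES OT
      by (rule mset_walk_edges[OF inj, symmetric]) (use return ev in simp)
  qed (use m2 inj in \<open>auto simp: C distinct_map atLeast0LessThan\<close>)
  moreover have "card (orbits (s \<circ> t) C) = 2"
  proof -
    have rel: "(?w (j mod 2), ?w j) \<in> orbit_rel (s \<circ> t) C" if "j < m" for j
      using that
    proof (induction j rule: less_induct)
      case (less j)
      consider "j = 0" | "j = 1" | k where "j = Suc (Suc k)"
        by (metis One_nat_def not0_implies_Suc)
      then show ?case
      proof cases
        case 3
        then have "j mod 2 = k mod 2" by simp
        then show ?thesis
          using 3 less walk_orbit_step[OF v C[symmetric], of k]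
          by (metis Suc_lessD lessI orbit_rel_trans)
      qed simp_all
    qed
    have in_C: "?w 0 \<in> C" "?w 1 \<in> C" unfolding C by (rule imageI, use m2 in simp)+
    let ?c = "\<lambda>u. orbit_rel (s \<circ> t) C `` {u}"
    have "orbits (s \<circ> t) C = {?c (?w 0), ?c (?w 1)}"
    proof -
      have "?c u \<in> {?c (?w 0), ?c (?w 1)}" if "u \<in> C" for u
      proof -
        from that obtain j where j: "j < m" "u = ?w j" unfolding C by blast
        then have "?c u = ?c (?w (j mod 2))"
          using rel[of j] orbit_rel_class_eq orbit_rel_sym by metis
        moreover have "j mod 2 = 0 \<or> j mod 2 = 1" by auto
        ultimately show ?thesis by (metis insertCI)
      qed
      then show ?thesis unfolding orbits_image using in_C by blast
    qed
    moreover have "?c (?w 0) \<noteq> ?c (?w 1)"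
    proof
      assume "?c (?w 0) = ?c (?w 1)"
      then have "(?w 0, ?w 1) \<in> orbit_rel (s \<circ> t) C" by (simp only: orbit_rel_class_eq)
      then have "(?w 0 \<in> E) = (?w 1 \<in> E)"
      proof (rule orbit_rel_invariant[where r = "\<lambda>u. u \<in> E"])
        fix a assume "a \<in> C"
        then have "a \<in> E \<or> a \<in> Od" using C CEO by blast
        then show "((s \<circ> t) a \<in> E) = (a \<in> E)"
          using s_E s_O t_E t_O EO by (auto simp: o_def)
      qed
      moreover have "?w 0 \<in> E" using m unfolding E_def by (intro image_eqI[of _ _ 0]) auto
      moreover have "?w 1 \<in> Od" using m2 unfolding Od_def by (intro image_eqI[of _ _ 1]) auto
      ultimately show False using EO by blast
    qed
    ultimately show ?thesis by simp
  qed
  ultimately show ?thesis unfolding C_def by blast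
qed

end

text \<open>A path may have an end fixed by \<open>s\<close> instead of \<open>t\<close>; exchanging
  the two involutions reduces this case to the one already treated.\<close>

sublocale two_involutions \<subseteq> swapped: two_involutions V t s
  by unfold_locales (simp_all add: finite_V s_closed s_s t_closed t_t)

context two_involutions
begin

lemma conn_swapped: "swapped.conn = conn"
  unfolding conn_def swapped.conn_def by (rule arg_cong[where f = rtrancl]) auto

lemma graph_edges_swapped: "swapped.graph_edges C = graph_edges C"
  unfolding graph_edges_def swapped.graph_edges_def by simp

lemma conn_class_closed:
  assumes "v \<in> V" "u \<in> conn `` {v}"
  shows "u \<in> V \<and> s u \<in> conn `` {v} \<and> t u \<in> conn `` {v}"
proof -
  have "(v, u) \<in> conn" using assms by simp
  then have "u \<in> V" unfolding conn_def
    by (induction rule: rtrancl_induct) (use assms(1) s_closed t_closed in auto)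
  moreover from this have "(u, s u) \<in> conn" "(u, t u) \<in> conn" unfolding conn_def by auto
  ultimately show ?thesis
    using \<open>(v, u) \<in> conn\<close> unfolding conn_def by (auto intro: rtrancl_trans)
qed

lemma orbits_swap:
  assumes "\<And>u. u \<in> C \<Longrightarrow> u \<in> V \<and> s u \<in> C \<and> t u \<in> C"
  shows "orbits (t \<circ> s) C = orbits (s \<circ> t) C"
proof -
  have "orbit_rel (t \<circ> s) C = orbit_rel (s \<circ> t) C"
    by (rule orbit_rel_inverse) (use assms s_s t_t in auto)
  then show ?thesis by (simp add: orbits_def)
qed

lemma class_dichotomy:
  assumes C: "C \<in> V // conn"
  shows "(path_graph (graph_edges C) C \<and> card (orbits (s \<circ> t) C) = 1) \<or>
    (cycle_graph (graph_edges C) C \<and> card (orbits (s \<circ> t) C) = 2)"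
proof -
  obtain v where v: "v \<in> V" "C = conn `` {v}" using C by (auto simp: quotient_def)
  consider u where "u \<in> C" "t u = u" | u where "u \<in> C" "s u = u"
    | "\<And>u. u \<in> C \<Longrightarrow> s u \<noteq> u \<and> t u \<noteq> u" by blast
  then show ?thesis
  proof cases
    case 1
    then have "u \<in> V" "conn `` {u} = C"
      using conn_class_closed[OF v(1), of u] v(2) eq_equiv_class_iff[OF equiv_conn, of v u] by auto
    then show ?thesis using path_class[of u] 1 by auto
  next
    case 2
    then have u: "u \<in> V" "conn `` {u} = C"
      using conn_class_closed[OF v(1), of u] v(2) eq_equiv_class_iff[OF equiv_conn, of v u] by auto
    have "orbits (t \<circ> s) C = orbits (s \<circ> t) C"
      by (rule orbits_swap) (use conn_class_closed[OF v(1)] v(2) in blast)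
    then show ?thesis
      using swapped.path_class[of u] 2 u by (simp add: conn_swapped graph_edges_swapped)
  next
    case 3
    then show ?thesis using cycle_class[OF v(1)] v(2) by auto
  qed
qed

lemma index_eq_card_orbits:
  "2 * card {C \<in> V // conn. cycle_graph (graph_edges C) C}
     + card {C \<in> V // conn. path_graph (graph_edges C) C} = card (orbits (s \<circ> t) V)"
proof -
  have fin: "finite (V // conn)" using finite_V by (simp add: quotient_def)
  have closed: "u \<in> V \<and> s u \<in> C \<and> t u \<in> C" if "C \<in> V // conn" "u \<in> C" for C u
    using that conn_class_closed by (auto simp: quotient_def)
  have refl: "(v, v) \<in> conn" for v by (simp add: conn_def)
  have Un: "(\<Union>C\<in>V // conn. C) = V"
  proof
    show "(\<Union>C\<in>V // conn. C) \<subseteq> V" using closed by blast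
    show "V \<subseteq> (\<Union>C\<in>V // conn. C)" using refl by (fastforce simp: quotient_def)
  qed
  \<comment> \<open>\<open>conn\<close> is reflexive on the whole type, so the disjointness of its
    classes is available for the quotient of \<open>UNIV\<close>.\<close>
  have sub: "V // conn \<subseteq> UNIV // conn" by (auto simp: quotient_def)
  have excl: "\<not> (path_graph E C \<and> cycle_graph E C)" for E and C :: "'a set"
    using path_graph_size[of E C] cycle_graph_size[of E C] by auto
  have "card (orbits (s \<circ> t) (\<Union>C\<in>V // conn. C)) = (\<Sum>C\<in>V // conn. card (orbits (s \<circ> t) C))"
  proof (rule card_orbits_UN)
    show "finite C" if "C \<in> V // conn" for C
      using that closed finite_V by (meson finite_subset subsetI)
    show "(s \<circ> t) u \<in> C" if "C \<in> V // conn" "u \<in> C" for C u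
      using closed[OF that] closed[OF that(1), of "t u"] by simp
    show "C \<inter> D = {}" if "C \<in> V // conn" "D \<in> V // conn" "C \<noteq> D" for C D
      using quotient_disj[OF equiv_conn] sub that by blast
  qed (rule fin)
  then have "card (orbits (s \<circ> t) V) = (\<Sum>C\<in>V // conn. card (orbits (s \<circ> t) C))"
    unfolding Un .
  also have "\<dots> = (\<Sum>C\<in>V // conn. 2 * (if cycle_graph (graph_edges C) C then 1 else 0)
      + (if path_graph (graph_edges C) C then 1 else 0))"
  proof (rule sum.cong)
    fix C assume "C \<in> V // conn"
    from class_dichotomy[OF this] show "card (orbits (s \<circ> t) C)
        = 2 * (if cycle_graph (graph_edges C) C then 1 else 0)
        + (if path_graph (graph_edges C) C then 1 else 0)"
      using excl[of "graph_edges C" C] by auto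
  qed simp
  also have "\<dots> = 2 * card {C \<in> V // conn. cycle_graph (graph_edges C) C}
     + card {C \<in> V // conn. path_graph (graph_edges C) C}"
    using fin by (simp add: sum.distrib sum_distrib_left[symmetric] sum.If_cases Int_def)
  finally show ?thesis by simp
qed

end

section \<open>Reductions of the index\<close>

text \<open>The middle vertex of an odd block, which carries no arc, becomes a fixed point. Ends of
  paths thus show up as fixed points of one of the two reflections.\<close>

fun reflect :: "nat list \<Rightarrow> nat \<Rightarrow> nat" where
  "reflect [] u = u"
| "reflect (a # as) u = (if u \<le> a then a + 1 - u else a + reflect as (u - a))"

lemma reflect_in: "u \<in> {1..sum_list as} \<Longrightarrow> reflect as u \<in> {1..sum_list as}"
proof (induction as arbitrary: u)
  case (Cons a as)
  show ?case
  proof (cases "u \<le> a")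
    case False
    then have "reflect as (u - a) \<in> {1..sum_list as}" using Cons.prems by (intro Cons.IH) auto
    then show ?thesis using False by auto
  qed (use Cons.prems in auto)
qed simp

lemma reflect_reflect: "u \<in> {1..sum_list as} \<Longrightarrow> reflect as (reflect as u) = u"
proof (induction as arbitrary: u)
  case (Cons a as)
  show ?case
  proof (cases "u \<le> a")
    case False
    then have u: "u - a \<in> {1..sum_list as}" using Cons.prems by auto
    then show ?thesis using False Cons.IH[OF u] reflect_in[OF u] by auto
  qed (use Cons.prems in auto)
qed simp

lemma reflect_ge_1: "u \<in> {1..sum_list as} \<Longrightarrow> 1 \<le> reflect as u"
  using reflect_in[of u as] by simp

lemma two_involutions_reflect:
  assumes "sum_list l = n" "sum_list m = n"
  shows "two_involutions {1..n} (reflect l) (reflect m)"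
proof
  fix v assume v: "v \<in> {1..n}"
  show "reflect l v \<in> {1..n}" "reflect l (reflect l v) = v"
    using v reflect_in[of v l] reflect_reflect[of v l] unfolding assms by blast+
  show "reflect m v \<in> {1..n}" "reflect m (reflect m v) = v"
    using v reflect_in[of v m] reflect_reflect[of v m] unfolding assms by blast+
qed simp

lemma finite_pair_edges: "finite C \<Longrightarrow> finite (pair_edges s C)"
proof -
  assume "finite C"
  moreover have "pair_edges s C \<subseteq> (\<lambda>u. {u, s u}) ` C" by (auto simp: pair_edges_def)
  ultimately show ?thesis by (meson finite_imageI finite_subset)
qed

text \<open>The set on the right meets each arc from both endpoints, the multiset on the left only
  from the lower one; they agree because the arcs of one composition are pairwise distinct. Arcs of
  the first block contain a vertex that is at most \<open>p + a\<close>, those of later blocks do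
  not.\<close>

lemma arcs_eq:
  "arcs p as = mset_set {{p + u, p + reflect as u} |u. u \<in> {1..sum_list as} \<and> reflect as u \<noteq> u}"
proof (induction as arbitrary: p)
  case (Cons a as)
  let ?A = "{{p + u, p + (a + 1 - u)} |u. u \<in> {1..a} \<and> a + 1 - u \<noteq> u}"
  let ?B = "{{p + a + u, p + a + reflect as u} |u. u \<in> {1..sum_list as} \<and> reflect as u \<noteq> u}"
  have inj: "inj_on (\<lambda>i. {p + i, p + a + 1 - i}) {1..a div 2}"
    by (rule inj_onI) (auto simp: doubleton_eq_iff)
  have "?A = (\<lambda>i. {p + i, p + a + 1 - i}) ` {1..a div 2}"
  proof (rule set_eqI, rule iffI)
    fix X assume "X \<in> ?A"
    then obtain u where u: "X = {p + u, p + (a + 1 - u)}" "u \<in> {1..a}" "a + 1 - u \<noteq> u" by blast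
    show "X \<in> (\<lambda>i. {p + i, p + a + 1 - i}) ` {1..a div 2}"
    proof (cases "u \<le> a div 2")
      case True
      then show ?thesis using u by (intro image_eqI[of _ _ u]) auto
    next
      case False
      then show ?thesis using u by (intro image_eqI[of _ _ "a + 1 - u"]) auto
    qed
  next
    fix X assume "X \<in> (\<lambda>i. {p + i, p + a + 1 - i}) ` {1..a div 2}"
    then obtain i where "i \<in> {1..a div 2}" "X = {p + i, p + a + 1 - i}" by blast
    then show "X \<in> ?A" by (intro CollectI exI[of _ i]) auto
  qed
  with inj have A: "image_mset (\<lambda>i. {p + i, p + a + 1 - i}) (mset_set {1..a div 2}) = mset_set ?A"
    by (simp add: image_mset_mset_set)
  have "{{p + u, p + reflect (a # as) u} |u. u \<in> {1..sum_list (a # as)} \<and> reflect (a # as) u \<noteq> u}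
      = ?A \<union> ?B" (is "?L = _")
  proof (rule set_eqI, rule iffI)
    fix X assume "X \<in> ?L"
    then obtain u where u: "X = {p + u, p + reflect (a # as) u}" "u \<in> {1..sum_list (a # as)}"
      "reflect (a # as) u \<noteq> u" by blast
    show "X \<in> ?A \<union> ?B"
    proof (cases "u \<le> a")
      case True
      then show ?thesis using u by auto
    next
      case False
      then have "X \<in> ?B" using u by (intro CollectI exI[of _ "u - a"]) auto
      then show ?thesis by blast
    qed
  next
    fix X assume "X \<in> ?A \<union> ?B"
    then show "X \<in> ?L"
    proof
      assume "X \<in> ?A"
      then obtain u where "X = {p + u, p + (a + 1 - u)}" "u \<in> {1..a}" "a + 1 - u \<noteq> u" by blast
      then show ?thesis by (intro CollectI exI[of _ u]) auto
    next
      assume "X \<in> ?B"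
      then obtain u where "X = {p + a + u, p + a + reflect as u}" "u \<in> {1..sum_list as}"
        "reflect as u \<noteq> u" by blast
      then show ?thesis by (intro CollectI exI[of _ "a + u"]) (auto simp: add.assoc)
    qed
  qed
  moreover have "?A \<inter> ?B = {}"
  proof -
    have "\<exists>e\<in>X. e \<le> p + a" if "X \<in> ?A" for X using that by auto
    moreover have "\<forall>e\<in>X. p + a < e" if "X \<in> ?B" for X using that reflect_ge_1[of _ as] by fastforce
    ultimately show ?thesis by (meson disjoint_iff linorder_not_le)
  qed
  moreover have "finite ?A" "finite ?B" by auto
  ultimately show ?case
    by (simp only: arcs.simps A Cons.IH[of "p + a"] mset_set_Union)
qed simp

lemma arcs_0: "arcs 0 as = mset_set (pair_edges (reflect as) {1..sum_list as})"
  unfolding arcs_eq pair_edges_def by simp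

definition ind :: "nat list \<Rightarrow> nat list \<Rightarrow> nat" where
  "ind l m = card (orbits (reflect l \<circ> reflect m) {1..sum_list l})"

lemma filter_pair_edges:
  assumes "C \<subseteq> V" "\<And>u. u \<in> C \<Longrightarrow> s u \<in> C"
  shows "{e \<in> pair_edges s V. e \<subseteq> C} = pair_edges s C"
proof -
  have "{u, s u} \<subseteq> C \<longleftrightarrow> u \<in> C" for u using assms(2) by blast
  then show ?thesis using assms(1) unfolding pair_edges_def by blast
qed

lemma meander_index_eq_ind:
  assumes eq: "sum_list l = sum_list m"
  shows "meander_index (l, m) = ind l m"
proof -
  let ?V = "{1..sum_list l}"
  interpret two_involutions ?V "reflect l" "reflect m"
    by (rule two_involutions_reflect) (use eq in simp_all)
  have edges: "edges (l, m) = mset_set (pair_edges (reflect l) ?V) + mset_set (pair_edges (reflect m) ?V)"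
    by (simp add: edges_def arcs_0 eq)
  let ?B = "{(u, w). u \<in> ?V \<and> (w = reflect l u \<or> w = reflect m u)}"
  \<comment> \<open>A fixed point of a reflection is a loop in \<open>?B\<close> but no arc of the
    meander; dropping the diagonal does not change the reflexive transitive closure.\<close>
  have adj: "{(u, v). {u, v} \<in># edges (l, m)} = ?B - Id"
  proof (rule set_eqI, clarify)
    fix u v
    have "{u, v} \<in> pair_edges s ?V \<longleftrightarrow> u \<in> ?V \<and> v = s u \<and> u \<noteq> v"
      if "\<And>u. u \<in> ?V \<Longrightarrow> s u \<in> ?V \<and> s (s u) = u" for s
      using that unfolding pair_edges_def mem_Collect_eq doubleton_eq_iff by metis
    from this[of "reflect l"] this[of "reflect m"]
    show "((u, v) \<in> {(u, v). {u, v} \<in># edges (l, m)}) = ((u, v) \<in> ?B - Id)"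
      using s_closed s_s t_closed t_t by (auto simp: edges finite_pair_edges)
  qed
  have comps: "components (l, m) = ?V // conn"
    unfolding components_def vertices_def conn_def adj rtrancl_r_diff_Id by simp
  have within: "edges_within (l, m) C = graph_edges C" if C: "C \<in> ?V // conn" for C
  proof -
    obtain v where v: "v \<in> ?V" "C = conn `` {v}" using C by (rule quotientE)
    have cl: "u \<in> ?V \<and> reflect l u \<in> C \<and> reflect m u \<in> C" if "u \<in> C" for u
      using conn_class_closed[OF v(1), of u] that unfolding v(2) by blast
    have "{e \<in> pair_edges (reflect l) ?V. e \<subseteq> C} = pair_edges (reflect l) C"
      "{e \<in> pair_edges (reflect m) ?V. e \<subseteq> C} = pair_edges (reflect m) C"
      by (rule filter_pair_edges; use cl in blast)+
    then show ?thesis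
      unfolding edges_within_def edges graph_edges_def
      by (simp only: filter_union_mset filter_mset_mset_set finite_pair_edges finite_atLeastAtMost)
  qed
  have "{C \<in> components (l, m). is_cycle_on (l, m) C} = {C \<in> ?V // conn. cycle_graph (graph_edges C) C}"
    unfolding comps is_cycle_on_def cycle_graph_def by (intro Collect_cong conj_cong refl) (simp only: within)
  moreover have "{C \<in> components (l, m). is_path_on (l, m) C} = {C \<in> ?V // conn. path_graph (graph_edges C) C}"
    unfolding comps is_path_on_def path_graph_def by (intro Collect_cong conj_cong refl) (simp only: within)
  ultimately show ?thesis
    unfolding meander_index_def ind_def using index_eq_card_orbits by simp
qed

section \<open>Symmetry of the index and reduction of leading parts\<close>

lemma ind_commute:
  assumes "sum_list l = sum_list m"
  shows "ind l m = ind m l"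
proof -
  interpret two_involutions "{1..sum_list l}" "reflect l" "reflect m"
    by (rule two_involutions_reflect) (use assms in simp_all)
  show ?thesis
    unfolding ind_def assms[symmetric] using orbits_swap[of "{1..sum_list l}"] s_closed t_closed by simp
qed

text \<open>On the common first block the two reversals cancel, so each of its \<open>a\<close>
  vertices is an orbit of its own. In the meander these are \<open>a div 2\<close> double arcs, each
  a cycle of weight 2, and an isolated middle vertex if \<open>a\<close> is odd.\<close>

lemma ind_Cons_Cons:
  assumes "sum_list l = sum_list m"
  shows "ind (a # l) (a # m) = a + ind l m"
proof -
  let ?n = "sum_list l"
  let ?p = "reflect (a # l) \<circ> reflect (a # m)" and ?q = "reflect l \<circ> reflect m"
  have id: "?p u = u" if "u \<in> {1..a}" for u using that by auto
  have p: "?p (a + u) = a + ?q u" if "u \<in> {1..?n}" for u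
    using that reflect_ge_1[of u m] assms by auto
  have q: "?q u \<in> {1..?n}" if "u \<in> {1..?n}" for u
    using that reflect_in[of u m] reflect_in[of "reflect m u" l] assms by auto
  have split: "{1..sum_list (a # l)} = {1..a} \<union> {a + 1..a + ?n}" by auto
  have p': "u - a \<in> {1..?n} \<and> ?p u = a + ?q (u - a)" if "u \<in> {a + 1..a + ?n}" for u
  proof -
    have u: "u - a \<in> {1..?n}" "a + (u - a) = u" using that by auto
    show ?thesis using p[OF u(1)] u(1) unfolding u(2) by blast
  qed
  have closed: "?p u \<in> {a + 1..a + ?n}" if "u \<in> {a + 1..a + ?n}" for u
    using p'[OF that] q[of "u - a"] by (simp del: reflect.simps o_apply)
  have "card (orbits ?p {a + 1..a + ?n}) = card (orbits ?q {1..?n})"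
  proof (rule card_orbits_retract[where i = "\<lambda>u. a + u" and r = "\<lambda>v. v - a"])
    fix u assume u: "u \<in> {1..?n}"
    show "(a + u, a + ?q u) \<in> orbit_rel ?p {a + 1..a + ?n}"
      unfolding p[OF u, symmetric] by (rule orbit_rel_step) (use u in auto)
  next
    fix v assume v: "v \<in> {a + 1..a + ?n}"
    have "?p v - a = ?q (v - a)" using p'[OF v] by (simp del: reflect.simps o_apply)
    moreover have "(v - a, ?q (v - a)) \<in> orbit_rel ?q {1..?n}"
      by (rule orbit_rel_step) (use v in auto)
    ultimately show "(v - a, ?p v - a) \<in> orbit_rel ?q {1..?n}" by simp
  qed auto
  moreover have "card (orbits ?p ({1..a} \<union> {a + 1..a + ?n}))
    = card (orbits ?p {1..a}) + card (orbits ?p {a + 1..a + ?n})"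
    by (rule card_orbits_Un) (use id closed in auto)
  moreover have "card (orbits ?p {1..a}) = a"
    using card_orbits_id[of "{1..a}" ?p] id by simp
  ultimately show ?thesis unfolding ind_def split by simp
qed

text \<open>Both reductions delete a prefix \<open>{1..d}\<close> of the vertices that an orbit leaves after
  a single step, so the shorter meander induces the first-return map on the rest.\<close>

lemma card_orbits_drop:
  fixes p q :: "nat \<Rightarrow> nat"
  assumes out: "\<And>v. v \<in> {1..d} \<Longrightarrow> p v \<in> {d + 1..d + n}"
    and inside: "\<And>u. u \<in> {1..n} \<Longrightarrow>
      p (d + u) = d + q u \<or> p (d + u) \<in> {1..d} \<and> p (p (d + u)) = d + q u"
    and q: "\<And>u. u \<in> {1..n} \<Longrightarrow> q u \<in> {1..n}"
  shows "card (orbits p {1..d + n}) = card (orbits q {1..n})"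
proof -
  let ?i = "\<lambda>u. d + u" and ?r = "\<lambda>v. if v \<le> d then p v - d else v - d"
  have step: "(u, q u) \<in> orbit_rel q {1..n}" if "u \<in> {1..n}" for u
    using that by (rule orbit_rel_step)
  have pstep: "(v, p v) \<in> orbit_rel p {1..d + n}" if "v \<in> {1..d + n}" for v
    using that by (rule orbit_rel_step)
  show ?thesis
  proof (rule card_orbits_retract[where i = ?i and r = ?r])
    fix u assume u: "u \<in> {1..n}"
    then have 1: "(d + u, p (d + u)) \<in> orbit_rel p {1..d + n}" by (intro pstep) auto
    from inside[OF u] show "(?i u, ?i (q u)) \<in> orbit_rel p {1..d + n}"
    proof
      assume "p (d + u) \<in> {1..d} \<and> p (p (d + u)) = d + q u"
      moreover from this have "(p (d + u), p (p (d + u))) \<in> orbit_rel p {1..d + n}"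
        by (intro pstep) auto
      ultimately show ?thesis using orbit_rel_trans[OF 1] by auto
    qed (use 1 in simp)
  next
    fix v assume v: "v \<in> {1..d + n}"
    show "?r v \<in> {1..n} \<and> (v, ?i (?r v)) \<in> orbit_rel p {1..d + n}"
    proof (cases "v \<le> d")
      case True
      then show ?thesis using out[of v] v pstep[of v] by auto
    qed (use v in auto)
    show "(?r v, ?r (p v)) \<in> orbit_rel q {1..n}"
    proof (cases "v \<le> d")
      case True
      then show ?thesis using out[of v] v by auto
    next
      case False
      then have vd: "v - d \<in> {1..n}" "d + (v - d) = v" using v by auto
      from inside[OF vd(1)] have "?r (p v) = q (v - d)"
        using q[OF vd(1)] unfolding vd(2) by auto
      then show ?thesis using step[OF vd(1)] False by simp
    qed
  qed auto
qed

text \<open>The reversal of the block \<open>b\<close> pairs its first \<open>a\<close> vertices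
  with its last \<open>a\<close> vertices. This pairing, the reversal of the block \<open>a\<close>
  and the pairing again compose to the reversal of the last \<open>a\<close> vertices. So after
  deletion the block \<open>b\<close> leaves its middle, of length \<open>b - 2 * a\<close>,
  followed by a block of length \<open>a\<close>.\<close>

lemma ind_reduce_double:
  assumes "2 * a < b" "a + sum_list l = b + sum_list m"
  shows "ind (a # l) (b # m) = ind l ((b - 2 * a) # a # m)"
proof -
  let ?n = "sum_list l" and ?m' = "(b - 2 * a) # a # m"
  have m': "sum_list ?m' = ?n" using assms by simp
  have in_l: "reflect l u \<in> {1..?n}" if "u \<in> {1..?n}" for u using that by (rule reflect_in)
  have "card (orbits (reflect (a # l) \<circ> reflect (b # m)) {1..a + ?n})
      = card (orbits (reflect l \<circ> reflect ?m') {1..?n})"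
  proof (rule card_orbits_drop)
    fix v assume v: "v \<in> {1..a}"
    then have "reflect (b # m) v = a + (b + 1 - v - a)" "b + 1 - v - a \<in> {1..?n}" using assms by auto
    then show "(reflect (a # l) \<circ> reflect (b # m)) v \<in> {a + 1..a + ?n}"
      using in_l[of "b + 1 - v - a"] by auto
  next
    fix u assume u: "u \<in> {1..?n}"
    \<comment> \<open>The ranges are the middle of the block \<open>b\<close>, its last
      \<open>a\<close> vertices, and the vertices behind it. Only from the second range does the
      orbit pass through the deleted prefix.\<close>
    consider "u \<le> b - 2 * a" | "b - 2 * a < u" "u \<le> b - a" | "b - a < u" by linarith
    then show "(reflect (a # l) \<circ> reflect (b # m)) (a + u) = a + (reflect l \<circ> reflect ?m') u \<or>
      (reflect (a # l) \<circ> reflect (b # m)) (a + u) \<in> {1..a} \<and>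
      (reflect (a # l) \<circ> reflect (b # m)) ((reflect (a # l) \<circ> reflect (b # m)) (a + u))
        = a + (reflect l \<circ> reflect ?m') u"
    proof cases
      case 1
      then have "reflect (b # m) (a + u) = a + reflect ?m' u" "reflect ?m' u \<ge> 1"
        using u assms by auto
      then show ?thesis by auto
    next
      case 2
      then have 1: "reflect (b # m) (a + u) = b + 1 - a - u" "b + 1 - a - u \<in> {1..a}"
        using u assms by auto
      then have 3: "(reflect (a # l) \<circ> reflect (b # m)) (a + u) = 2 * a + u - b" using 2 by auto
      have "reflect (b # m) (2 * a + u - b) = a + reflect ?m' u" "reflect ?m' u \<ge> 1"
        using 2 assms u by auto
      then have 4: "(reflect (a # l) \<circ> reflect (b # m)) (2 * a + u - b) = a + (reflect l \<circ> reflect ?m') u"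
        by simp
      show ?thesis unfolding 3 by (rule disjI2, rule conjI[OF _ 4]) (use 2 in auto)
    next
      case 3
      have 1: "u - (b - 2 * a) - a = a + u - b" using 3 assms by auto
      have 2: "a + u - b \<in> {1..sum_list m}" using 3 u assms by auto
      have "reflect (b # m) (a + u) = b + reflect m (a + u - b)" using 3 by auto
      moreover have "reflect ?m' u = b - a + reflect m (a + u - b)" using 3 1 assms by auto
      moreover have "a < b" using assms by simp
      ultimately have "reflect (b # m) (a + u) = a + reflect ?m' u" "reflect ?m' u \<ge> 1"
        by linarith+
      then show ?thesis by auto
    qed
  next
    fix u assume "u \<in> {1..?n}"
    then show "(reflect l \<circ> reflect ?m') u \<in> {1..?n}"
      using reflect_in[of u ?m'] in_l m' by auto
  qed
  then show ?thesis unfolding ind_def by simp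
qed

text \<open>Where both reversals act within their first blocks, their composition is the translation
  by \<open>b - a\<close>. Without the first \<open>b - a\<close> vertices the blocks have lengths
  \<open>2 * a - b\<close> and \<open>a\<close> and again a common start, and their reversals
  compose to the same translation. By \<open>b < 2 * a\<close> the deleted vertices lie inside the
  block \<open>a\<close>.\<close>

lemma ind_reduce_single:
  assumes "a < b" "b < 2 * a" "a + sum_list l = b + sum_list m"
  shows "ind (a # l) (b # m) = ind ((2 * a - b) # l) (a # m)"
proof -
  let ?d = "b - a" and ?n = "a + sum_list m"
  let ?l' = "(2 * a - b) # l" and ?m' = "a # m"
  have l': "sum_list ?l' = ?n" using assms by simp
  have "card (orbits (reflect (b # m) \<circ> reflect (a # l)) {1..?d + ?n})
      = card (orbits (reflect ?m' \<circ> reflect ?l') {1..?n})"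
  proof (rule card_orbits_drop)
    fix v assume "v \<in> {1..?d}"
    then show "(reflect (b # m) \<circ> reflect (a # l)) v \<in> {?d + 1..?d + ?n}" using assms by auto
  next
    fix u assume u: "u \<in> {1..?n}"
    show "(reflect (b # m) \<circ> reflect (a # l)) (?d + u) = ?d + (reflect ?m' \<circ> reflect ?l') u \<or>
      (reflect (b # m) \<circ> reflect (a # l)) (?d + u) \<in> {1..?d} \<and>
      (reflect (b # m) \<circ> reflect (a # l)) ((reflect (b # m) \<circ> reflect (a # l)) (?d + u))
        = ?d + (reflect ?m' \<circ> reflect ?l') u"
    proof (cases "?d + u \<le> a")
      case True
      then have "reflect (a # l) (?d + u) = a + 1 - (?d + u)"
        "reflect (b # m) (a + 1 - (?d + u)) = ?d + (?d + u)" using assms by auto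
      moreover have "reflect ?l' u = 2 * a - b + 1 - u" "reflect ?m' (2 * a - b + 1 - u) = ?d + u"
        using True assms u by auto
      ultimately show ?thesis by simp
    next
      case False
      define w where "w = reflect l (?d + u - a)"
      have "?d + u - a \<in> {1..sum_list l}" using False u assms by auto
      then have w: "w \<in> {1..sum_list l}" unfolding w_def by (rule reflect_in)
      have 1: "reflect (a # l) (?d + u) = a + w" using False by (simp add: w_def)
      have "u - (2 * a - b) = ?d + u - a" using False assms by auto
      then have 2: "reflect ?l' u = 2 * a - b + w" using False assms by (auto simp: w_def)
      \<comment> \<open>If \<open>a + w\<close> still lies in the block \<open>b\<close>, its mirror
        image falls into the deleted prefix, and one more step, a translation by
        \<open>b - a\<close>, leads out of it.\<close>
      show ?thesis
      proof (cases "a + w \<le> b")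
        case True
        then have 3: "(reflect (b # m) \<circ> reflect (a # l)) (?d + u) = b + 1 - (a + w)"
          using 1 by simp
        have 4: "(reflect (b # m) \<circ> reflect (a # l)) (b + 1 - (a + w)) = ?d + (b + 1 - (a + w))"
          using True w assms by auto
        have 5: "(reflect ?m' \<circ> reflect ?l') u = b + 1 - (a + w)"
          using 2 True assms by auto
        have "b + 1 - (a + w) \<in> {1..?d}" using True w by auto
        then show ?thesis unfolding 3 4 5 by blast
      next
        case False
        have e: "2 * a - b + w - a = a + w - b" using False assms by auto
        have "reflect ?m' (2 * a - b + w) = a + reflect m (a + w - b)"
          using False assms e by auto
        then have "(reflect ?m' \<circ> reflect ?l') u = a + reflect m (a + w - b)" using 2 by simp
        moreover have "(reflect (b # m) \<circ> reflect (a # l)) (?d + u) = b + reflect m (a + w - b)"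
          using 1 False by simp
        ultimately show ?thesis using assms by simp
      qed
    qed
  next
    fix u assume "u \<in> {1..?n}"
    then show "(reflect ?m' \<circ> reflect ?l') u \<in> {1..?n}"
      using reflect_in[of u ?l'] reflect_in[of "reflect ?l' u" ?m'] l' by auto
  qed
  moreover have sums: "sum_list (b # m) = ?d + ?n" "sum_list ?m' = ?n" using assms by auto
  ultimately have "ind (b # m) (a # l) = ind ?m' ?l'" unfolding ind_def sums by blast
  moreover have "ind (b # m) (a # l) = ind (a # l) (b # m)"
    by (rule ind_commute) (use assms in simp)
  moreover have "ind ?m' ?l' = ind ?l' ?m'"
    by (rule ind_commute) (use l' in simp)
  ultimately show ?thesis by (simp only:)
qed

text \<open>Vertex \<open>v\<close> becomes the \<open>c\<close> vertices \<open>c * (v - 1) + i\<close>; each of the two reflections reverses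
  \<open>i\<close>, so their composition preserves it.\<close>

lemma reflect_scale:
  assumes "u \<in> {1..sum_list as}" "i \<in> {1..c}"
  shows "reflect (map ((*) c) as) (c * (u - 1) + i) = c * (reflect as u - 1) + (c + 1 - i)"
  using assms
proof (induction as arbitrary: u)
  case (Cons a as)
  show ?case
  proof (cases "u \<le> a")
    case True
    then obtain d where d: "a = u + d" using le_Suc_ex by blast
    obtain v where v: "u = Suc v" using Cons.prems by (cases u) auto
    have "c * (u - 1) + i \<le> c * a" using Cons.prems d v by (simp add: algebra_simps)
    then show ?thesis using True d v Cons.prems by (simp add: algebra_simps)
  next
    case False
    then obtain w where w: "u = a + Suc w" using less_imp_Suc_add by (metis add_Suc_right not_le)
    have u: "u - a \<in> {1..sum_list as}" using Cons.prems False by auto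
    have "\<not> c * (u - 1) + i \<le> c * a" using Cons.prems w by (simp add: algebra_simps)
    moreover have "c * (u - 1) + i - c * a = c * (u - a - 1) + i"
      using w by (simp add: algebra_simps)
    ultimately have "reflect (map ((*) c) (a # as)) (c * (u - 1) + i)
        = c * a + (c * (reflect as (u - a) - 1) + (c + 1 - i))"
      using Cons.IH[OF u Cons.prems(2)] by simp
    moreover obtain r where "reflect as (u - a) = Suc r"
      using reflect_ge_1[OF u] by (cases "reflect as (u - a)") auto
    ultimately show ?thesis using False by (simp add: distrib_left)
  qed
qed simp

lemma scaled_interval:
  fixes c n :: nat
  shows "{1..c * n} = (\<Union>i\<in>{1..c}. (\<lambda>u. c * (u - 1) + i) ` {1..n})"
proof (rule set_eqI, rule iffI)
  fix v assume v: "v \<in> {1..c * n}"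
  then have c: "0 < c" by (cases c) auto
  \<comment> \<open>Vertices are numbered from 1, so quotient and remainder are those of
    \<open>v - 1\<close>, and both are shifted back by 1.\<close>
  have "(v - 1) div c < n"
    using v by (subst div_less_iff_less_mult) (use c in \<open>auto simp: mult.commute\<close>)
  moreover have "v = c * ((v - 1) div c + 1 - 1) + ((v - 1) mod c + 1)" using v by simp
  moreover have "(v - 1) mod c + 1 \<in> {1..c}" using c by (simp add: Suc_leI)
  ultimately show "v \<in> (\<Union>i\<in>{1..c}. (\<lambda>u. c * (u - 1) + i) ` {1..n})"
    by (intro UN_I[of "(v - 1) mod c + 1"] image_eqI[of _ _ "(v - 1) div c + 1"]) auto
next
  fix v assume "v \<in> (\<Union>i\<in>{1..c}. (\<lambda>u. c * (u - 1) + i) ` {1..n})"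
  then obtain i u where iu: "i \<in> {1..c}" "u \<in> {1..n}" "v = c * (u - 1) + i" by blast
  then obtain w where w: "u = Suc w" by (cases u) auto
  have "c * (u - 1) + i \<le> c * u" using iu w by simp
  also have "\<dots> \<le> c * n" using iu by simp
  finally show "v \<in> {1..c * n}" using iu by auto
qed

text \<open>Truncated subtraction cannot tell \<open>u = 0\<close> from \<open>u = 1\<close>, hence
  the conclusion in terms of \<open>u - 1\<close>.\<close>

lemma scaled_vertex_inj:
  fixes c :: nat
  assumes "i \<in> {1..c}" "j \<in> {1..c}" "c * (u - 1) + i = c * (v - 1) + j"
  shows "u - 1 = v - 1 \<and> i = j"
proof -
  obtain i' j' where ij: "i = Suc i'" "j = Suc j'" "i' < c" "j' < c"
    using assms by (cases i; cases j) auto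
  then have e: "c * (u - 1) + i' = c * (v - 1) + j'" using assms by simp
  have "(c * (u - 1) + i') div c = u - 1" "(c * (u - 1) + i') mod c = i'"
    "(c * (v - 1) + j') div c = v - 1" "(c * (v - 1) + j') mod c = j'"
    using ij by auto
  then show ?thesis using e ij by metis
qed

lemma ind_scale:
  assumes "sum_list l = sum_list m"
  shows "ind (map ((*) c) l) (map ((*) c) m) = c * ind l m"
proof -
  let ?n = "sum_list l"
  let ?p = "reflect (map ((*) c) l) \<circ> reflect (map ((*) c) m)" and ?q = "reflect l \<circ> reflect m"
  let ?e = "\<lambda>i u. c * (u - 1) + i"
  have q: "?q u \<in> {1..?n}" if "u \<in> {1..?n}" for u
    using that reflect_in[of u m] reflect_in[of "reflect m u" l] assms by auto
  have p: "?p (?e i u) = ?e i (?q u)" if "u \<in> {1..?n}" "i \<in> {1..c}" for i u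
  proof -
    have 1: "reflect (map ((*) c) m) (?e i u) = ?e (c + 1 - i) (reflect m u)"
      by (rule reflect_scale) (use that assms in auto)
    have "reflect (map ((*) c) l) (?e (c + 1 - i) (reflect m u))
        = ?e (c + 1 - (c + 1 - i)) (reflect l (reflect m u))"
      by (rule reflect_scale) (use that assms reflect_in[of u m] in auto)
    with 1 that show ?thesis by simp
  qed
  have inj: "inj_on (?e i) {1..?n}" if "i \<in> {1..c}" for i
  proof (rule inj_onI)
    fix u v assume uv: "u \<in> {1..?n}" "v \<in> {1..?n}" and e: "?e i u = ?e i v"
    show "u = v" using scaled_vertex_inj[OF that that e] uv by auto
  qed
  have "card (orbits ?p (?e i ` {1..?n})) = card (orbits ?q {1..?n})" if i: "i \<in> {1..c}" for i
  proof (rule card_orbits_retract[where i = "?e i" and r = "inv_into {1..?n} (?e i)"])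
    fix u assume u: "u \<in> {1..?n}"
    show "?e i u \<in> ?e i ` {1..?n} \<and> inv_into {1..?n} (?e i) (?e i u) = u"
      using inv_into_f_f[OF inj[OF i] u] u by blast
    show "(?e i u, ?e i (?q u)) \<in> orbit_rel ?p (?e i ` {1..?n})"
      unfolding p[OF u i, symmetric] by (rule orbit_rel_step) (use u in blast)
  next
    fix v assume "v \<in> ?e i ` {1..?n}"
    then obtain u where u: "u \<in> {1..?n}" "v = ?e i u" by blast
    show "inv_into {1..?n} (?e i) v \<in> {1..?n} \<and>
        (v, ?e i (inv_into {1..?n} (?e i) v)) \<in> orbit_rel ?p (?e i ` {1..?n})"
      unfolding u(2) inv_into_f_f[OF inj[OF i] u(1)] using u(1) by simp
    show "(inv_into {1..?n} (?e i) v, inv_into {1..?n} (?e i) (?p v)) \<in> orbit_rel ?q {1..?n}"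
      unfolding u(2) p[OF u(1) i] inv_into_f_f[OF inj[OF i] u(1)]
        inv_into_f_f[OF inj[OF i] q[OF u(1)]]
      by (rule orbit_rel_step) (rule u(1))
  qed
  moreover have "card (orbits ?p (\<Union>i\<in>{1..c}. ?e i ` {1..?n}))
      = (\<Sum>i\<in>{1..c}. card (orbits ?p (?e i ` {1..?n})))"
  proof (rule card_orbits_UN)
    fix i v assume "i \<in> {1..c}" "v \<in> ?e i ` {1..?n}"
    then show "?p v \<in> ?e i ` {1..?n}" using p q by fastforce
  next
    fix i j assume "i \<in> {1..c}" "j \<in> {1..c}" "i \<noteq> j"
    then show "?e i ` {1..?n} \<inter> ?e j ` {1..?n} = {}" using scaled_vertex_inj by blast
  qed auto
  moreover have "sum_list (map ((*) c) l) = c * ?n" by (simp add: sum_list_const_mult)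
  ultimately show ?thesis unfolding ind_def by (simp add: scaled_interval del: One_nat_def)
qed

section \<open>Generating functions\<close>

text \<open>Only the tails vary, since a reduction rewrites prefixes and leaves tails alone.
  Prefixes may contain parts outside \<open>J\<close>, such as 3, and \<open>n\<close> and
  \<open>k\<close> measure the whole meander, prefixes included.\<close>

definition completions ::
    "nat set \<Rightarrow> nat list \<Rightarrow> nat list \<Rightarrow> nat \<Rightarrow> nat \<Rightarrow> (nat list \<times> nat list) set" where
  "completions J P Q n k = {(l, m). set l \<subseteq> J \<and> set m \<subseteq> J \<and>
     sum_list (P @ l) = n \<and> sum_list (Q @ m) = n \<and> ind (P @ l) (Q @ m) = k}"

definition prefix_gf :: "nat set \<Rightarrow> nat list \<Rightarrow> nat list \<Rightarrow> bifps" where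
  "prefix_gf J P Q = Abs_fps (\<lambda>n. Abs_fps (\<lambda>k. of_nat (card (completions J P Q n k))))"

lemma prefix_gf_nth: "prefix_gf J P Q $ n $ k = of_nat (card (completions J P Q n k))"
  by (simp add: prefix_gf_def)

lemma bifps_eqI: "(\<And>n k. F $ n $ k = G $ n $ k) \<Longrightarrow> F = (G :: bifps)"
  by (simp add: fps_eq_iff)

lemma bifps_monom_mult_nth:
  "(fps_X ^ i * fps_const fps_X ^ j * (F :: bifps)) $ n $ k
    = (if i \<le> n \<and> j \<le> k then F $ (n - i) $ (k - j) else 0)"
proof -
  have "fps_X ^ i * fps_const fps_X ^ j * F = fps_X ^ i * (fps_const (fps_X ^ j) * F)"
    by (simp add: fps_const_power mult.assoc)
  then show ?thesis
    by (simp only: fps_X_power_mult_nth fps_mult_left_const_nth) (auto simp: fps_X_power_mult_nth)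
qed

lemma length_le_sum_list: "0 \<notin> set xs \<Longrightarrow> length xs \<le> sum_list (xs :: nat list)"
  by (induction xs) auto

lemma finite_completions:
  assumes "finite J" "0 \<notin> J"
  shows "finite (completions J P Q n k)"
proof -
  have "completions J P Q n k
      \<subseteq> {l. set l \<subseteq> J \<and> length l \<le> n} \<times> {m. set m \<subseteq> J \<and> length m \<le> n}"
  proof (clarsimp simp: completions_def)
    fix l m
    assume "set l \<subseteq> J" "set m \<subseteq> J" "sum_list Q + sum_list m = sum_list P + sum_list l"
    then show "length l \<le> sum_list P + sum_list l \<and> length m \<le> sum_list P + sum_list l"
      using length_le_sum_list[of l] length_le_sum_list[of m] assms(2) by fastforce
  qed
  then show ?thesis
    using finite_lists_length_le[OF assms(1)] by (meson finite_SigmaI finite_subset)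
qed

lemma prefix_gf_commute: "prefix_gf J P Q = prefix_gf J Q P"
proof (rule bifps_eqI)
  fix n k
  have "completions J Q P n k = prod.swap ` completions J P Q n k"
  proof (rule set_eqI, rule iffI)
    fix z assume "z \<in> completions J Q P n k"
    then have "prod.swap z \<in> completions J P Q n k"
      using ind_commute[of "Q @ fst z" "P @ snd z"] by (auto simp: completions_def)
    then show "z \<in> prod.swap ` completions J P Q n k" by (intro image_eqI[of _ _ "prod.swap z"]) auto
  next
    fix z assume "z \<in> prod.swap ` completions J P Q n k"
    then obtain l m where "z = (m, l)" "(l, m) \<in> completions J P Q n k" by auto
    then show "z \<in> completions J Q P n k"
      using ind_commute[of "P @ l" "Q @ m"] by (auto simp: completions_def)
  qed
  then show "prefix_gf J P Q $ n $ k = prefix_gf J Q P $ n $ k"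
    by (simp add: prefix_gf_nth card_image)
qed

text \<open>Both sides must reach the same sum, so the side with the smaller prefix sum has a next
  part; that part is moved into the prefix.\<close>

lemma prefix_gf_split:
  assumes J: "finite J" "0 \<notin> J" and lt: "sum_list P < sum_list Q"
  shows "prefix_gf J P Q = (\<Sum>a\<in>J. prefix_gf J (P @ [a]) Q)"
proof (rule bifps_eqI)
  fix n k
  let ?S = "\<lambda>a. (\<lambda>(l, m). (a # l, m)) ` completions J (P @ [a]) Q n k"
  have "completions J P Q n k = (\<Union>a\<in>J. ?S a)"
  proof (rule set_eqI, rule iffI)
    fix z assume z: "z \<in> completions J P Q n k"
    then obtain l m where lm: "z = (l, m)" by (cases z)
    have "l \<noteq> []" using z lt lm by (auto simp: completions_def)
    then obtain a l' where "l = a # l'" by (cases l) auto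
    with z lm have "a \<in> J" "(l', m) \<in> completions J (P @ [a]) Q n k" "z = (a # l', m)"
      by (auto simp: completions_def)
    then show "z \<in> (\<Union>a\<in>J. ?S a)" by (intro UN_I[of a] image_eqI[of _ _ "(l', m)"]) auto
  qed (auto simp: completions_def)
  moreover have "card (\<Union>a\<in>J. ?S a) = (\<Sum>a\<in>J. card (?S a))"
    by (rule card_UN_disjoint) (use J finite_completions[OF J] in auto)
  moreover have "card (?S a) = card (completions J (P @ [a]) Q n k)" for a
    by (rule card_image) (auto simp: inj_on_def)
  ultimately show "prefix_gf J P Q $ n $ k = (\<Sum>a\<in>J. prefix_gf J (P @ [a]) Q) $ n $ k"
    by (simp add: prefix_gf_nth fps_sum_nth)
qed

lemma ind_Nil [simp]: "ind [] [] = 0"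
  by (simp add: ind_def orbits_image)

text \<open>With equal prefix sums neither side is forced to continue. The empty meander contributes
  the 1; otherwise both sides have a first part because parts are positive.\<close>

lemma prefix_gf_Nil:
  assumes J: "finite J" "0 \<notin> J"
  shows "prefix_gf J [] [] = 1 + (\<Sum>a\<in>J. \<Sum>b\<in>J. prefix_gf J [a] [b])"
proof (rule bifps_eqI)
  fix n k
  let ?S = "\<lambda>(a, b). (\<lambda>(l, m). (a # l, b # m)) ` completions J [a] [b] n k"
  let ?E = "if n = 0 \<and> k = 0 then {([], [])} else {} :: (nat list \<times> nat list) set"
  have "completions J [] [] n k = ?E \<union> (\<Union>z\<in>J \<times> J. ?S z)"
  proof (rule set_eqI, rule iffI)
    fix z assume z: "z \<in> completions J [] [] n k"
    then obtain l m where lm: "z = (l, m)" by (cases z)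
    show "z \<in> ?E \<union> (\<Union>z\<in>J \<times> J. ?S z)"
    proof (cases "l = [] \<or> m = []")
      case True
      then have "n = 0" using z lm by (auto simp: completions_def)
      then have "l = [] \<and> m = []" using z lm J(2) by (cases l; cases m) (auto simp: completions_def)
      then show ?thesis using z lm by (auto simp: completions_def)
    next
      case False
      then obtain a l' b m' where "l = a # l'" "m = b # m'" by (cases l; cases m) auto
      with z lm have "a \<in> J" "b \<in> J" "(l', m') \<in> completions J [a] [b] n k" "z = (a # l', b # m')"
        by (auto simp: completions_def)
      then show ?thesis by (intro UnI2 UN_I[of "(a, b)"]) (auto intro!: image_eqI[of _ _ "(l', m')"])
    qed
  qed (auto simp: completions_def split: if_splits)
  moreover have "card (?E \<union> (\<Union>z\<in>J \<times> J. ?S z)) = card ?E + card (\<Union>z\<in>J \<times> J. ?S z)"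
    by (rule card_Un_disjoint) (use J finite_completions[OF J] in auto)
  moreover have "card (\<Union>z\<in>J \<times> J. ?S z) = (\<Sum>z\<in>J \<times> J. card (?S z))"
    by (rule card_UN_disjoint) (use J finite_completions[OF J] in auto)
  moreover have "card (?S (a, b)) = card (completions J [a] [b] n k)" for a b
    unfolding prod.case by (rule card_image) (auto simp: inj_on_def)
  moreover have "of_nat (card ?E) = (1 :: bifps) $ n $ k" by auto
  ultimately show "prefix_gf J [] [] $ n $ k
      = (1 + (\<Sum>a\<in>J. \<Sum>b\<in>J. prefix_gf J [a] [b])) $ n $ k"
    by (simp add: prefix_gf_nth fps_sum_nth sum.cartesian_product case_prod_unfold)
qed

text \<open>The index identity holds for all tails, so a reduction becomes multiplication by one
  monomial: \<open>i\<close> counts the vertices lost, \<open>j\<close> the orbits split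
  off.\<close>

lemma prefix_gf_reduce:
  assumes P: "sum_list P = i + sum_list P'" and Q: "sum_list Q = i + sum_list Q'"
    and ind: "\<And>l m. sum_list (P @ l) = sum_list (Q @ m) \<Longrightarrow>
      ind (P @ l) (Q @ m) = j + ind (P' @ l) (Q' @ m)"
  shows "prefix_gf J P Q = fps_X ^ i * fps_const fps_X ^ j * prefix_gf J P' Q'"
proof (rule bifps_eqI)
  fix n k
  have iff: "(l, m) \<in> completions J P Q n k \<longleftrightarrow>
      i \<le> n \<and> j \<le> k \<and> (l, m) \<in> completions J P' Q' (n - i) (k - j)" for l m
    using ind[of l m] P Q unfolding completions_def by auto
  have "completions J P Q n k
      = (if i \<le> n \<and> j \<le> k then completions J P' Q' (n - i) (k - j) else {})"
    using iff by auto
  then show "prefix_gf J P Q $ n $ k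
      = (fps_X ^ i * fps_const fps_X ^ j * prefix_gf J P' Q') $ n $ k"
    unfolding bifps_monom_mult_nth prefix_gf_nth by simp
qed

lemma meander_gf_eq_prefix_gf:
  assumes "0 \<notin> J"
  shows "meander_gf J = prefix_gf J [] []"
proof -
  have "{M. is_meander n M \<and> set (fst M) \<subseteq> J \<and> set (snd M) \<subseteq> J \<and> meander_index M = k}
      = completions J [] [] n k" for n k
    using assms meander_index_eq_ind
    by (fastforce simp: is_meander_def composition_def completions_def intro!: gr0I)
  then show ?thesis by (simp add: meander_gf_def meander_count_def prefix_gf_def)
qed

text \<open>Powers of \<open>x\<close> record deleted vertices, and \<open>y\<close> enters only
  when equal leading parts cancel. The factor 2 in the first equation stems from the first parts 1
  over 5 and 5 over 1, which have equal series by symmetry.\<close>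

lemma prefix_gf_equations:
  fixes x y :: bifps
  assumes x: "x = fps_X" and y: "y = fps_const fps_X"
  defines "F \<equiv> prefix_gf {1, 5}"
  shows "F [] [] = 1 + x*y * F [] [] + x^5*y^5 * F [] [] + 2*x * F [] [3, 1]"
    and "F [] [3, 1] = x * F [] [1, 1, 1] + x^4*y * F [] [1]"
    and "F [] [1, 1, 1] = (x*y + x^3*y) * F [] [1, 1]"
    and "F [] [1, 1] = x*y * F [] [1] + x^2 * F [] [1, 1, 1]"
    and "F [] [1] = x*y * F [] [] + x * F [] [3, 1]"
proof -
  have comm: "F P Q = F Q P" for P Q unfolding F_def by (rule prefix_gf_commute)
  have split: "F [] Q = F [1] Q + F [5] Q" if "0 < sum_list Q" for Q
    using prefix_gf_split[of "{1, 5}" "[]" Q] that unfolding F_def by simp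
  have reduce: "F P Q = x ^ i * y ^ j * F P' Q'"
    if "sum_list P = i + sum_list P'" "sum_list Q = i + sum_list Q'"
      "\<And>l m. sum_list (P @ l) = sum_list (Q @ m) \<Longrightarrow> ind (P @ l) (Q @ m) = j + ind (P' @ l) (Q' @ m)"
    for P Q i j P' Q'
    unfolding F_def x y using that by (rule prefix_gf_reduce)
  have double: "F (a # P) (b # Q) = x ^ a * F P ((b - 2 * a) # a # Q)" if "2 * a < b" for a b P Q
    using reduce[of "a # P" a P "b # Q" "(b - 2 * a) # a # Q" 0] that
    by (simp add: ind_reduce_double)
  have single: "F (a # P) (b # Q) = x ^ (b - a) * F ((2 * a - b) # P) (a # Q)"
    if "a < b" "b < 2 * a" for a b P Q
    using reduce[of "a # P" "b - a" "(2 * a - b) # P" "b # Q" "a # Q" 0] that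
    by (simp add: ind_reduce_single)
  have same: "F (a # P) (a # Q) = x ^ a * y ^ a * F P Q" for a P Q
    using reduce[of "a # P" a P "a # Q" Q a] by (simp add: ind_Cons_Cons)
  have 15: "F [1] [5] = x * F [] [3, 1]" using double[of 1 5 "[]" "[]"] by simp
  have "F [] [] = 1 + (F [1] [1] + F [1] [5] + (F [5] [1] + F [5] [5]))"
    using prefix_gf_Nil[of "{1, 5}"] unfolding F_def by simp
  then show "F [] [] = 1 + x*y * F [] [] + x^5*y^5 * F [] [] + 2*x * F [] [3, 1]"
    using 15 comm[of "[5]" "[1]"] same[of 1 "[]" "[]"] same[of 5 "[]" "[]"] by (simp add: algebra_simps)
  \<comment> \<open>Of the pairs of leading parts that occur, 3 and 5 form the only one with ratio
    strictly between 1 and 2.\<close>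
  have "F [5] [3, 1] = x ^ 2 * F [1, 1] [3]"
    using single[of 3 5 "[1]" "[]"] comm[of "[5]" "[3, 1]"] by simp
  also have "F [1, 1] [3] = x * F [1] [1, 1]" using double[of 1 3 "[1]" "[]"] by simp
  also have "F [1] [1, 1] = x * y * F [] [1]" using same[of 1 "[]" "[1]"] by simp
  finally have 53: "F [5] [3, 1] = x^4*y * F [] [1]" by (simp add: power_eq_if mult.assoc)
  have "F [1] [3, 1] = x * F [] [1, 1, 1]" using double[of 1 3 "[]" "[1]"] by simp
  with 53 show "F [] [3, 1] = x * F [] [1, 1, 1] + x^4*y * F [] [1]"
    using split[of "[3, 1]"] by simp
  have "F [5] [1, 1, 1] = x * F [1, 1] [3, 1]"
    using double[of 1 5 "[1, 1]" "[]"] comm[of "[5]" "[1, 1, 1]"] by simp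
  also have "F [1, 1] [3, 1] = x * F [1] [1, 1, 1]" using double[of 1 3 "[1]" "[1]"] by simp
  also have "F [1] [1, 1, 1] = x * y * F [] [1, 1]" using same[of 1 "[]" "[1, 1]"] by simp
  finally have "F [5] [1, 1, 1] = x^3*y * F [] [1, 1]" by (simp add: power_eq_if mult.assoc)
  with \<open>F [1] [1, 1, 1] = x * y * F [] [1, 1]\<close>
  show "F [] [1, 1, 1] = (x*y + x^3*y) * F [] [1, 1]"
    using split[of "[1, 1, 1]"] by (simp add: distrib_right)
  have "F [5] [1, 1] = x * F [1] [3, 1]"
    using double[of 1 5 "[1]" "[]"] comm[of "[5]" "[1, 1]"] by simp
  also have "F [1] [3, 1] = x * F [] [1, 1, 1]" by fact
  finally have "F [5] [1, 1] = x^2 * F [] [1, 1, 1]" by (simp add: power_eq_if mult.assoc)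
  with \<open>F [1] [1, 1] = x * y * F [] [1]\<close>
  show "F [] [1, 1] = x*y * F [] [1] + x^2 * F [] [1, 1, 1]"
    using split[of "[1, 1]"] by simp
  show "F [] [1] = x*y * F [] [] + x * F [] [3, 1]"
    using split[of "[1]"] same[of 1 "[]" "[]"] 15 comm[of "[5]" "[1]"] by simp
qed

text \<open>This is Cramer's rule: \<open>f\<close> is the determinant of the last four equations in
  \<open>T\<close>, \<open>S3\<close>, \<open>S2\<close>, \<open>S1\<close>, and \<open>g\<close>
  that of all five. The elimination avoids division: \<open>D\<close> is the determinant of the pair
  \<open>S2\<close>, \<open>S3\<close>, and \<open>N\<close> is the coefficient in
  \<open>D * T = N * S1\<close>, which gives \<open>f = D - x * N\<close>.\<close>

lemma linear_system_solution:
  fixes x y S0 S1 S2 S3 T :: "'a :: comm_ring_1"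
  assumes S0: "S0 = 1 + x*y * S0 + x^5*y^5 * S0 + 2*x * T"
    and T: "T = x * S3 + x^4*y * S1"
    and S3: "S3 = (x*y + x^3*y) * S2"
    and S2: "S2 = x*y * S1 + x^2 * S3"
    and S1: "S1 = x*y * S0 + x * T"
    and f: "f = 1 - x^3*y - x^4*y^2 - 2*x^5*y - x^6*y^2 + x^8*y^2 + x^10*y^2"
    and g: "g = (1 - x*y - x^5*y^5) * f - 2*x^5*y^2 * (x + y + x^2*y - x^4*y - x^6*y)"
  shows "g * S0 = f"
proof -
  define D where "D = 1 - x^3*y - x^5*y"
  define N where "N = x^3*y^2 + x^5*y^2 + x^4*y*D"
  have f_eq: "f = D - x * N"
    unfolding f N_def D_def by (simp add: algebra_simps power_eq_if)
  have "D * S2 = S2 - x^2 * ((x*y + x^3*y) * S2)"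
    unfolding D_def by (simp add: algebra_simps power_eq_if)
  then have DS2: "D * S2 = x*y * S1"
    using S2 unfolding S3[symmetric] by (simp add: algebra_simps)
  have "D * T = x * (x*y + x^3*y) * (D * S2) + x^4*y*D * S1"
    by (subst T, subst S3) (simp add: algebra_simps)
  also have "\<dots> = N * S1"
    unfolding DS2 N_def by (simp add: algebra_simps power_eq_if)
  also have "\<dots> = N * (x*y) * S0 + x * N * T"
    by (subst S1) (simp add: algebra_simps)
  finally have fT: "f * T = N * (x*y) * S0"
    unfolding f_eq by (simp add: algebra_simps)
  have "(1 - x*y - x^5*y^5) * S0 = 1 + 2*x * T"
    using S0 by (simp add: algebra_simps)
  then have "f * ((1 - x*y - x^5*y^5) * S0) = f * (1 + 2*x * T)"
    by (simp only:)
  also have "\<dots> = f + 2*x * (f * T)"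
    by (simp add: algebra_simps)
  also have "\<dots> = f + 2*x^5*y^2 * (x + y + x^2*y - x^4*y - x^6*y) * S0"
    unfolding fT N_def D_def by (simp add: algebra_simps power_eq_if)
  finally show ?thesis unfolding g by (simp add: algebra_simps)
qed

text \<open>The coefficients to which this is applied are series in \<open>y\<close> and form no
  field, so the quotient rests on the constant coefficient 1 of \<open>g\<close>. The class
  \<open>inverse\<close> is purely syntactic, hence the premise on \<open>inverse 1\<close>.\<close>

lemma fps_div_eqI_of_one:
  fixes f g h :: "'a :: {comm_ring_1, inverse} fps"
  assumes g0: "g $ 0 = 1" and one: "inverse (1 :: 'a) = 1" and eq: "g * h = f"
  shows "g dvd 1 \<and> h = f / g"
proof -
  have inv: "g * inverse g = 1"
    unfolding fps_inverse_def by (rule fps_right_inverse) (simp add: g0 one)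
  have "f / g = f * inverse g" by (rule fps_divide_unit) (simp add: g0)
  also have "\<dots> = h * (g * inverse g)" unfolding eq[symmetric] by (simp add: mult_ac)
  finally show ?thesis using inv by (metis dvdI mult_1_right)
qed

section \<open>Scaling all parts by a constant\<close>

lemma fps_compose_X_power_nth:
  assumes "0 < c"
  shows "(F oo fps_X ^ c) $ n = (if c dvd n then F $ (n div c) else 0)"
proof -
  have "(F oo fps_X ^ c) $ n = (\<Sum>i\<in>{0..n}. if n = c * i then F $ i else 0)"
    unfolding fps_compose_nth
    by (rule sum.cong) (auto simp: power_mult[symmetric] fps_X_power_nth)
  also have "\<dots> = (\<Sum>i\<in>{0..n}. if i = n div c \<and> c dvd n then F $ i else 0)"
    by (rule sum.cong) (use assms in auto)
  also have "\<dots> = (if c dvd n then F $ (n div c) else 0)"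
    by auto
  finally show ?thesis .
qed

text \<open>Dividing all parts by \<open>c\<close> divides the size by \<open>c\<close> and, by
  \<open>ind_scale\<close>, the index as well; so there is nothing unless \<open>c\<close> divides
  both.\<close>

lemma completions_scale:
  assumes "0 < c"
  shows "completions ((*) c ` J) [] [] n k = (if c dvd n \<and> c dvd k then
    map_prod (map ((*) c)) (map ((*) c)) ` completions J [] [] (n div c) (k div c) else {})"
    (is "_ = ?R")
proof (rule set_eqI, rule iffI)
  fix z assume z: "z \<in> completions ((*) c ` J) [] [] n k"
  have "\<exists>l'. l = map ((*) c) l' \<and> set l' \<subseteq> J" if "set l \<subseteq> (*) c ` J" for l
    using that by (induction l) (auto, metis list.simps(9) insert_subset list.simps(15))
  moreover obtain l m where lm: "z = (l, m)" by (cases z)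
  ultimately obtain l' m' where l': "l = map ((*) c) l'" "set l' \<subseteq> J"
    and m': "m = map ((*) c) m'" "set m' \<subseteq> J"
    using z unfolding completions_def by blast
  have sums: "c * sum_list l' = n" "c * sum_list m' = n"
    using z unfolding lm completions_def l'(1) m'(1) by (simp_all add: sum_list_const_mult)
  then have "sum_list l' = sum_list m'" using assms by (metis mult_left_cancel not_gr0)
  then have "c * ind l' m' = k"
    using z ind_scale[of l' m' c] unfolding lm completions_def l'(1) m'(1) by simp
  with sums assms l' m' lm show "z \<in> ?R"
    unfolding completions_def by (auto intro!: image_eqI[of _ _ "(l', m')"])
next
  fix z assume z: "z \<in> ?R"
  then have dvd: "c dvd n" "c dvd k" by (auto split: if_splits)
  with z obtain l m where lm: "z = (map ((*) c) l, map ((*) c) m)"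
    "(l, m) \<in> completions J [] [] (n div c) (k div c)" by auto
  then show "z \<in> completions ((*) c ` J) [] [] n k"
    using ind_scale[of l m c] dvd unfolding completions_def
    by (auto simp: sum_list_const_mult)
qed

lemma meander_gf_scale:
  assumes c: "0 < c" and J: "0 \<notin> J"
  shows "meander_gf ((*) c ` J) = subst_powers c (meander_gf J)"
proof (rule bifps_eqI)
  fix n k
  have "inj (map_prod (map ((*) c)) (map ((*) c)))"
    by (intro prod.inj_map list.inj_map) (use c in \<open>auto simp: inj_def\<close>)
  then have "card (completions ((*) c ` J) [] [] n k)
      = (if c dvd n \<and> c dvd k then card (completions J [] [] (n div c) (k div c)) else 0)"
    unfolding completions_scale[OF c] by (simp add: card_image inj_on_subset)
  moreover have "0 \<notin> (*) c ` J" using c J by auto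
  ultimately show "meander_gf ((*) c ` J) $ n $ k = subst_powers c (meander_gf J) $ n $ k"
    using J c by (simp add: meander_gf_eq_prefix_gf prefix_gf_nth subst_powers_def
        fps_compose_X_power_nth)
qed

theorem theorem3p8:
  fixes x y f g :: bifps
  assumes x: "x = fps_X"
    and y: "y = fps_const fps_X"
    and f: "f = 1 - x^3*y - x^4*y^2 - 2*x^5*y - x^6*y^2 + x^8*y^2 + x^10*y^2"
    and g: "g = (1 - x*y - x^5*y^5) * f - 2*x^5*y^2 * (x + y + x^2*y - x^4*y - x^6*y)"
  shows "g dvd 1 \<and> meander_gf {1, 5} = f / g \<and>
    (\<forall>c\<ge>1. meander_gf {c, 5 * c} = subst_powers c (meander_gf {1, 5}))"
proof -
  have gf: "meander_gf {1, 5} = prefix_gf {1, 5} [] []"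
    by (rule meander_gf_eq_prefix_gf) simp
  have "g * meander_gf {1, 5} = f"
    unfolding gf by (rule linear_system_solution[OF prefix_gf_equations[OF x y] f g])
  moreover have "g $ 0 = 1" unfolding g f x y by simp
  ultimately have "g dvd 1 \<and> meander_gf {1, 5} = f / g"
    by (intro fps_div_eqI_of_one) simp_all
  moreover have "meander_gf {c, 5 * c} = subst_powers c (meander_gf {1, 5})" if "c \<ge> 1" for c
    using meander_gf_scale[of c "{1, 5}"] that by (simp add: mult.commute)
  ultimately show ?thesis by blast
qed

end
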